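(* Let $\Gamma\subset\mathbb{R}^2$ be a simple closed curve such that every set of $6$ points of $\Gamma$ is in c.s.c. position. Then $\Gamma$ is the boundary of a centrally symmetric convex region (i.e., there is a point $O$ such that $\Gamma$ bounds a convex body and $2O-\Gamma=\Gamma$).
   Context: A set of points in $\mathbb{R}^2$ is in c.s.c. position (centrally symmetric convex position) if it is contained in the boundary of a centrally symmetric convex body (compact convex set with nonempty interior). *)

theory Defs
  imports "HOL-Analysis.Analysis"
begin

definition convex_body :: "(real^2) set \<Rightarrow> bool" where
  "convex_body K \<longleftrightarrow> compact K \<and> convex K \<and> interior K \<noteq> {}"

definition centrally_symmetric :: "(real^2) set \<Rightarrow> bool" where
  "centrally_symmetric K \<longleftrightarrow> (\<exists>c. \<forall>x\<in>K. 2 *\<^sub>R c - x \<in> K)"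

definition csc_position :: "(real^2) set \<Rightarrow> bool" where
  "csc_position S \<longleftrightarrow>
     (\<exists>K. convex_body K \<and> centrally_symmetric K \<and> S \<subseteq> frontier K)"

end

theory Submission
  imports Defs
begin

text \<open>
  By Steinitz's argument the curve lies on the frontier of its convex hull \<open>K\<close>, and by the
  Jordan--Brouwer theorem it is all of that frontier. For the symmetry, consider a parallelogram
  inscribed in the curve with two vertical sides. If the curve leaves both strips spanned by
  opposite sides, its vertices together with one point outside each strip admit only the centre
  of the parallelogram as centre of symmetry; a one-dimensional Helly argument over all such pairs
  of points then gives parallel supporting lines of \<open>K\<close> at the ends of each diagonal. Take as
  horizontal axis a diameter of \<open>K\<close>, so that vertical chords shrink to points at both ends, and
  for each length \<open>l\<close> below the maximum take the leftmost and the rightmost vertical chord of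
  length \<open>l\<close>. The supporting lines force the centres of these parallelograms to move by at most
  the change in slope times the change in \<open>l\<close>, so the centre is constant. Hence \<open>K\<close> is
  symmetric about it.
\<close>

subsection \<open>Points supported together with their reflection\<close>

text \<open>What remains of c.s.c. position once the body is forgotten: a centre \<open>c\<close>
  and, at each point, a line with \<open>S\<close> and its reflection on one side. This passes to
  subsets and through affine maps.\<close>

definition centrally_supported :: "'a::euclidean_space set \<Rightarrow> bool" where
  "centrally_supported S \<longleftrightarrow>
     (\<exists>c. \<forall>x\<in>S. \<exists>f. f \<noteq> 0 \<and> (\<forall>y\<in>S. f \<bullet> y \<le> f \<bullet> x \<and> f \<bullet> (2 *\<^sub>R c - y) \<le> f \<bullet> x))"

lemma frontier_support:
  fixes K :: "'a::euclidean_space set"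
  assumes "convex K" "closed K" "x \<in> frontier K"
  obtains f where "f \<noteq> 0" "\<And>y. y \<in> K \<Longrightarrow> f \<bullet> y \<le> f \<bullet> x"
proof (cases "interior K = {}")
  case True
  have xK: "x \<in> K" using assms by (simp add: frontier_def)
  obtain a b where "a \<noteq> 0" "K \<subseteq> {y. a \<bullet> y = b}"
    using empty_interior_subset_hyperplane[OF assms(1) True] by blast
  with xK that[of a] show ?thesis by (metis (mono_tags) mem_Collect_eq order_refl subsetD)
next
  case False
  have xK: "x \<in> K" and xi: "x \<notin> rel_interior K"
    using assms False by (auto simp: frontier_def interior_rel_interior_gen rel_interior_nonempty_interior)
  from supporting_hyperplane_rel_boundary[OF assms(1) xK xi]
  obtain a where "a \<noteq> 0" "\<And>y. y \<in> K \<Longrightarrow> a \<bullet> x \<le> a \<bullet> y" by metis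
  then show ?thesis using that[of "-a"] by simp
qed

text \<open>The body contains the reflection of \<open>S\<close> as well, so a line supporting the
  body at a point of \<open>S\<close> bounds both sets.\<close>

lemma csc_position_imp_centrally_supported:
  assumes "csc_position S"
  shows "centrally_supported S"
proof -
  obtain K where K: "convex_body K" "centrally_symmetric K" "S \<subseteq> frontier K"
    using assms unfolding csc_position_def by blast
  then have cK: "closed K" "convex K" by (auto simp: convex_body_def compact_imp_closed)
  obtain c where c: "\<And>x. x \<in> K \<Longrightarrow> 2 *\<^sub>R c - x \<in> K"
    using K(2) unfolding centrally_symmetric_def by blast
  have SK: "S \<subseteq> K" using K(3) frontier_subset_closed[OF cK(1)] by blast
  show ?thesis unfolding centrally_supported_def
  proof (rule exI[of _ c], rule ballI)
    fix x assume "x \<in> S"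
    then have "x \<in> frontier K" using K(3) by blast
    from frontier_support[OF cK(2,1) this] obtain f
      where "f \<noteq> 0" "\<And>y. y \<in> K \<Longrightarrow> f \<bullet> y \<le> f \<bullet> x" by metis
    then show "\<exists>f. f \<noteq> 0 \<and> (\<forall>y\<in>S. f \<bullet> y \<le> f \<bullet> x \<and> f \<bullet> (2 *\<^sub>R c - y) \<le> f \<bullet> x)"
      using SK c by blast
  qed
qed

lemma centrally_supported_subset:
  "centrally_supported T \<Longrightarrow> S \<subseteq> T \<Longrightarrow> centrally_supported S"
  unfolding centrally_supported_def by blast

text \<open>Functionals are pulled back by the adjoint, which kills none of them because
  \<open>T\<close> is onto, and the centre to a preimage. So coordinates may be chosen freely, for
  the whole region and for a single parallelogram.\<close>

lemma centrally_supported_affine_vimage: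
  fixes T :: "'a::euclidean_space \<Rightarrow> 'b::euclidean_space"
  assumes "linear T" "surj T" "centrally_supported ((\<lambda>x. w + T x) ` S)"
  shows "centrally_supported S"
proof -
  obtain c where c: "\<And>x. x \<in> S \<Longrightarrow> \<exists>f. f \<noteq> 0 \<and>
      (\<forall>y\<in>S. f \<bullet> (w + T y) \<le> f \<bullet> (w + T x) \<and> f \<bullet> (2 *\<^sub>R c - (w + T y)) \<le> f \<bullet> (w + T x))"
    using assms(3) unfolding centrally_supported_def by auto
  obtain c' where c': "T c' = c - w" using assms(2) by (metis surjD)
  show ?thesis unfolding centrally_supported_def
  proof (rule exI[of _ c'], rule ballI)
    fix x assume "x \<in> S"
    then obtain f where f: "f \<noteq> 0"
      "\<And>y. y \<in> S \<Longrightarrow> f \<bullet> (w + T y) \<le> f \<bullet> (w + T x) \<and> f \<bullet> (2 *\<^sub>R c - (w + T y)) \<le> f \<bullet> (w + T x)"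
      using c by blast
    let ?g = "adjoint T f"
    have g: "?g \<bullet> y = f \<bullet> T y" for y
      using adjoint_works[OF assms(1), of y f] by (simp add: inner_commute)
    have "?g \<noteq> 0"
    proof
      assume "?g = 0"
      then have "f \<bullet> T y = 0" for y using g[of y] by simp
      then have "f \<bullet> f = 0" using assms(2) by (metis surjD)
      with f(1) show False by simp
    qed
    moreover have "?g \<bullet> y \<le> ?g \<bullet> x \<and> ?g \<bullet> (2 *\<^sub>R c' - y) \<le> ?g \<bullet> x" if "y \<in> S" for y
    proof -
      have T: "T (2 *\<^sub>R c' - y) = 2 *\<^sub>R (c - w) - T y"
        by (simp add: linear_diff[OF assms(1)] linear_cmul[OF assms(1)] c')
      show ?thesis using f(2)[OF that] unfolding g T
        by (simp add: inner_add_right inner_diff_right)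
    qed
    ultimately show "\<exists>f. f \<noteq> 0 \<and> (\<forall>y\<in>S. f \<bullet> y \<le> f \<bullet> x \<and> f \<bullet> (2 *\<^sub>R c' - y) \<le> f \<bullet> x)"
      by blast
  qed
qed

subsection \<open>The curve as the frontier of its convex hull\<close>

lemma inner_vec2: "x \<bullet> y = x $ 1 * y $ 1 + x $ 2 * y $ 2" for x y :: "real^2"
  by (simp add: inner_vec_def sum_2)

lemma orthogonal_common_parallel:
  fixes f v w :: "real^2"
  assumes "f \<noteq> 0" "f \<bullet> v = 0" "f \<bullet> w = 0" "w \<noteq> 0"
  obtains k where "v = k *\<^sub>R w"
proof -
  have fn: "f $ 1 \<noteq> 0 \<or> f $ 2 \<noteq> 0" using assms(1) by (auto simp: vec_eq_iff forall_2)
  have wn: "w $ 1 \<noteq> 0 \<or> w $ 2 \<noteq> 0" using assms(4) by (auto simp: vec_eq_iff forall_2)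
  have a: "f$1 * v$1 + f$2 * v$2 = 0" and b: "f$1 * w$1 + f$2 * w$2 = 0"
    using assms by (auto simp: inner_vec2)
  have det: "v$1 * w$2 = v$2 * w$1"
  proof (cases "f$1 = 0")
    case True
    then show ?thesis using a b fn by auto
  next
    case False
    have "f$1 * (v$1 * w$2 - v$2 * w$1) = 0" using a b by algebra
    with False show ?thesis by simp
  qed
  show ?thesis
  proof (cases "w$1 = 0")
    case True
    then have "v = (v$2 / w$2) *\<^sub>R w" using wn det by (auto simp: vec_eq_iff forall_2)
    then show ?thesis using that by blast
  next
    case False
    then have "v = (v$1 / w$1) *\<^sub>R w" using det by (simp add: vec_eq_iff forall_2 nonzero_eq_divide_eq)
    then show ?thesis using that by blast
  qed
qed

lemma convex_hull_le_functional:
  fixes f :: "'a::real_inner"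
  assumes "x \<in> convex hull S" "\<And>y. y \<in> S \<Longrightarrow> f \<bullet> y \<le> c"
  shows "f \<bullet> x \<le> c"
proof -
  have "convex hull S \<subseteq> {y. f \<bullet> y \<le> c}"
    by (rule hull_minimal) (use assms(2) convex_halfspace_le in auto)
  then show ?thesis using assms(1) by blast
qed

lemma convex_hull_less_functional:
  fixes f :: "'a::real_inner"
  assumes "x \<in> convex hull S" "\<And>y. y \<in> S \<Longrightarrow> f \<bullet> y < c"
  shows "f \<bullet> x < c"
proof -
  have "convex hull S \<subseteq> {y. f \<bullet> y < c}"
    by (rule hull_minimal) (use assms(2) convex_halfspace_lt in auto)
  then show ?thesis using assms(1) by blast
qed

lemma interior_functional_less:
  fixes f :: "'a::real_inner"
  assumes "p \<in> interior K" "f \<noteq> 0" "\<And>y. y \<in> K \<Longrightarrow> f \<bullet> y \<le> c"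
  shows "f \<bullet> p < c"
proof -
  obtain e where e: "e > 0" "cball p e \<subseteq> K" using assms(1) mem_interior_cball by blast
  have "p + (e / norm f) *\<^sub>R f \<in> K" using e assms(2) by (auto simp: dist_norm intro!: subsetD[OF e(2)])
  then have "f \<bullet> p + (e / norm f) * (f \<bullet> f) \<le> c" using assms(3) by (fastforce simp: inner_add_right)
  moreover have "(e / norm f) * (f \<bullet> f) > 0" using e assms(2) by simp
  ultimately show ?thesis by linarith
qed

text \<open>Steinitz's argument. If \<open>p\<close> were interior, the ray from some
  \<open>a\<close> in \<open>G\<close> through \<open>p\<close> would leave the hull at a point
  \<open>z\<close> of \<open>G\<close>. A line supporting \<open>a\<close> and \<open>z\<close> at
  \<open>p\<close>, which is between them, contains both; points \<open>c\<close>, \<open>e\<close>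
  of \<open>G\<close> strictly on either side of it then give a contradiction. Four points suffice:
  \<open>a\<close> with three Caratheodory points to place \<open>z\<close> in \<open>G\<close>,
  then \<open>a\<close>, \<open>z\<close>, \<open>c\<close>, \<open>e\<close>.\<close>

lemma locally_supported_not_interior:
  fixes G :: "(real^2) set"
  assumes bd: "bounded G"
    and supp: "\<And>S p. finite S \<Longrightarrow> card S \<le> 4 \<Longrightarrow> S \<subseteq> G \<Longrightarrow> p \<in> G
                 \<Longrightarrow> \<exists>f. f \<noteq> 0 \<and> (\<forall>y\<in>S. f \<bullet> y \<le> f \<bullet> p)"
    and cl: "closed (convex hull G)"
    and pG: "p \<in> G"
  shows "p \<notin> interior (convex hull G)"
proof
  let ?K = "convex hull G"
  assume p: "p \<in> interior ?K"
  have "\<exists>a\<in>G. a \<noteq> p"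
  proof (rule ccontr)
    assume "\<not> (\<exists>a\<in>G. a \<noteq> p)"
    with pG have "G = {p}" by blast
    with p show False by (simp add: interior_singleton)
  qed
  then obtain a where a: "a \<in> G" "a \<noteq> p" by blast
  have bK: "bounded ?K" using bd bounded_convex_hull by blast
  obtain d where d: "d > 0" "p + d *\<^sub>R (p - a) \<in> frontier ?K"
    using ray_to_frontier[OF bK p, of "p - a"] a by (metis right_minus_eq)
  define z where "z = p + d *\<^sub>R (p - a)"
  have zf: "z \<in> frontier ?K" using d z_def by simp
  then have zK: "z \<in> ?K" using frontier_subset_closed[OF cl] by blast
  obtain h where h: "h \<noteq> 0" "\<And>y. y \<in> ?K \<Longrightarrow> h \<bullet> y \<le> h \<bullet> z"
    using frontier_support[OF convex_convex_hull cl zf] by metis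
  have hp: "h \<bullet> p < h \<bullet> z" by (rule interior_functional_less[OF p h])
  have combo: "f \<bullet> a = f \<bullet> p \<and> f \<bullet> z = f \<bullet> p" if "f \<bullet> a \<le> f \<bullet> p" "f \<bullet> z \<le> f \<bullet> p" for f
  proof -
    have "f \<bullet> z - f \<bullet> p = d * (f \<bullet> p - f \<bullet> a)"
      by (simp add: z_def inner_add_right inner_diff_right)
    moreover have "d * (f \<bullet> p - f \<bullet> a) \<ge> 0" using d that by simp
    moreover from calculation have "f \<bullet> z = f \<bullet> p" using that by linarith
    ultimately show ?thesis using d by auto
  qed
  \<comment> \<open>A line supporting the points at hand at \<open>p\<close> contains \<open>a\<close> and \<open>z\<close>; it meets the line
      supporting \<open>K\<close> at \<open>z\<close> in \<open>z\<close> alone, so \<open>z\<close> is one of the points that span it.\<close>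
  have zG: "z \<in> G"
  proof -
    obtain S where S: "finite S" "S \<subseteq> G" "card S \<le> 3" "z \<in> convex hull S"
      using zK unfolding caratheodory[of G] by auto
    have "card (insert a S) \<le> 4" using S by (simp add: card_insert_if)
    then obtain f where f: "f \<noteq> 0" "\<forall>y\<in>insert a S. f \<bullet> y \<le> f \<bullet> p"
      using supp[of "insert a S" p] S a pG by auto
    have "f \<bullet> z \<le> f \<bullet> p" using convex_hull_le_functional[OF S(4)] f by blast
    with f have fz: "f \<bullet> a = f \<bullet> p" "f \<bullet> z = f \<bullet> p" using combo by blast+
    have "\<exists>s\<in>S. f \<bullet> s = f \<bullet> z \<and> h \<bullet> s = h \<bullet> z"
    proof (rule ccontr)
      assume n: "\<not> ?thesis"
      \<comment> \<open>On \<open>S\<close> both functionals are at most their values at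
        \<open>z\<close>. Without a common point of equality their sum is strictly smaller on
        \<open>S\<close>, hence on its hull.\<close>
      have "(f + h) \<bullet> s < (f + h) \<bullet> z" if "s \<in> S" for s
      proof -
        have "f \<bullet> s \<le> f \<bullet> z" using f(2) fz(2) that by (metis insertI2)
        moreover have "h \<bullet> s \<le> h \<bullet> z" using h(2) that S(2) hull_inc by (metis subsetD)
        moreover have "f \<bullet> s \<noteq> f \<bullet> z \<or> h \<bullet> s \<noteq> h \<bullet> z" using n that by blast
        ultimately show ?thesis unfolding inner_add_left by linarith
      qed
      from convex_hull_less_functional[OF S(4) this] show False by simp
    qed
    then obtain s where s: "s \<in> S" "f \<bullet> s = f \<bullet> z" "h \<bullet> s = h \<bullet> z" by blast
    have "f \<bullet> (s - z) = 0" "f \<bullet> (p - z) = 0" "p - z \<noteq> 0"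
      using s fz hp by (auto simp: inner_diff_right)
    from orthogonal_common_parallel[OF f(1) this]
    obtain k where k: "s - z = k *\<^sub>R (p - z)" by blast
    have "h \<bullet> (s - z) = 0" using s by (simp add: inner_diff_right)
    then have "k * (h \<bullet> (p - z)) = 0" by (simp add: k)
    then have "k = 0" using hp by (simp add: inner_diff_right)
    then have "s = z" using k by simp
    then show ?thesis using s(1) S(2) by blast
  qed
  define n where "n = (vector [- (p - a) $ 2, (p - a) $ 1] :: real^2)"
  have n0: "n \<noteq> 0" using a by (auto simp: n_def vec_eq_iff forall_2)
  have na: "n \<bullet> (p - a) = 0" by (simp add: n_def inner_vec2 algebra_simps)
  have both: "\<exists>c\<in>G. m \<bullet> c > m \<bullet> p" if m0: "m \<noteq> 0" for m
  proof (rule ccontr)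
    assume "\<not> ?thesis"
    then have "m \<bullet> y \<le> m \<bullet> p" if "y \<in> ?K" for y
      using convex_hull_le_functional[OF that, of m "m \<bullet> p"] by (simp add: not_less)
    from interior_functional_less[OF p m0 this] show False by simp
  qed
  obtain c where c: "c \<in> G" "n \<bullet> c > n \<bullet> p" using both[OF n0] by blast
  obtain e where e: "e \<in> G" "(- n) \<bullet> e > (- n) \<bullet> p" using both[of "- n"] n0 by auto
  have "card {a, z, c, e} \<le> 4" using card_length[of "[a, z, c, e]"] by simp
  then obtain f where f: "f \<noteq> 0" "\<forall>y\<in>{a, z, c, e}. f \<bullet> y \<le> f \<bullet> p"
    using supp[of "{a, z, c, e}" p] a zG c e pG by auto
  then have "f \<bullet> a = f \<bullet> p" using combo by blast
  then have "(p - a) \<bullet> f = 0" by (simp add: inner_diff_right inner_commute)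
  then obtain k where k: "f = k *\<^sub>R n"
    using orthogonal_common_parallel[of "p - a" f n] a n0 na by (auto simp: inner_commute)
  have "k \<noteq> 0" using f k by auto
  moreover have "k * (n \<bullet> c - n \<bullet> p) \<le> 0" "k * (n \<bullet> e - n \<bullet> p) \<le> 0"
    using f(2) by (auto simp: k algebra_simps)
  ultimately show False using c(2) e(2) by (auto simp: mult_le_0_iff)
qed

text \<open>The exterior of the hull stays connected when frontier points off the curve are added.
  If the hull had no interior, this would be the whole complement of the curve; a frontier point
  \<open>q\<close> off the curve would join exterior and interior. Either way the complement would
  be connected, against Jordan--Brouwer.\<close>

lemma closed_curve_eq_frontier_convex_hull:
  fixes g :: "real \<Rightarrow> real^2"
  assumes g: "simple_path g" "pathfinish g = pathstart g"
    and dis: "path_image g \<inter> interior (convex hull (path_image g)) = {}"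
  shows "frontier (convex hull (path_image g)) = path_image g"
    and "interior (convex hull (path_image g)) \<noteq> {}"
proof -
  let ?G = "path_image g"
  let ?K = "convex hull ?G"
  have cG: "compact ?G" using g compact_simple_path_image by blast
  then have cK: "compact ?K" using compact_convex_hull by blast
  have clK: "closed ?K" using cK compact_imp_closed by blast
  have "?G homeomorphic sphere (0::complex) 1"
    using homeomorphic_simple_path_image_circle[OF g] by simp
  also have "sphere (0::complex) 1 homeomorphic sphere (0::real^2) 1"
    by (rule homeomorphic_spheres_gen) auto
  finally have nc: "\<not> connected (- ?G)" using Jordan_Brouwer_separation by fastforce
  have cC: "connected (- ?K)"
    by (rule connected_complement_bounded_convex) (use cK compact_imp_bounded in auto)
  have GK: "?G \<subseteq> ?K" by (rule hull_subset)
  have fr: "frontier ?K = ?K - interior ?K" using clK by (simp add: frontier_def)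
  have frcl: "frontier ?K \<subseteq> closure (- ?K)" by (simp add: frontier_closures)
  have Y: "connected (- ?K \<union> (frontier ?K - ?G))"
    by (rule connected_intermediate_closure[OF cC]) (use frcl closure_subset[of "- ?K"] in blast)+
  show ne: "interior ?K \<noteq> {}"
  proof
    assume "interior ?K = {}"
    then have "- ?K \<union> (frontier ?K - ?G) = - ?G" using fr GK by auto
    then show False using Y nc by simp
  qed
  have "q \<in> ?G" if q: "q \<in> frontier ?K" for q
  proof (rule ccontr)
    assume qn: "q \<notin> ?G"
    have "q \<in> closure (interior ?K)"
      using q convex_closure_interior[OF convex_convex_hull ne] by (simp add: frontier_def)
    then have "insert q (interior ?K) \<subseteq> closure (interior ?K)"
      using closure_subset[of "interior ?K"] by blast
    then have X: "connected (insert q (interior ?K))"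
      using connected_intermediate_closure[of "interior ?K" "insert q (interior ?K)"]
        convex_connected[OF convex_interior[OF convex_convex_hull[of ?G]]] by blast
    have "connected (insert q (interior ?K) \<union> (- ?K \<union> (frontier ?K - ?G)))"
      by (rule connected_Un[OF X Y]) (use q qn in auto)
    moreover have "insert q (interior ?K) \<union> (- ?K \<union> (frontier ?K - ?G)) = - ?G"
      using fr GK dis qn by auto
    ultimately show False using nc by simp
  qed
  then show "frontier ?K = ?G" using fr GK dis by auto
qed

subsection \<open>Supporting lines at an inscribed parallelogram\<close>

text \<open>Helly's theorem on a line, for two families whose members meet within each family. The
  supremum of the left ends \<open>a i\<close> lies in every \<open>I i\<close>. Each
  \<open>a i\<close> lies in every \<open>J j\<close>, since the two sets meet at or to the right of
  \<open>a i\<close>, and closedness carries this over to the supremum.\<close>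

lemma common_point_of_up_and_down_closed:
  fixes I J :: "'i \<Rightarrow> real set"
  assumes clI: "\<And>i. i \<in> P \<Longrightarrow> closed (I i)"
    and up: "\<And>i x y. i \<in> P \<Longrightarrow> x \<in> I i \<Longrightarrow> 0 \<le> x \<Longrightarrow> x \<le> y \<Longrightarrow> y \<le> 1 \<Longrightarrow> y \<in> I i"
    and clJ: "\<And>j. j \<in> Q \<Longrightarrow> closed (J j)"
    and down: "\<And>j x y. j \<in> Q \<Longrightarrow> x \<in> J j \<Longrightarrow> 0 \<le> y \<Longrightarrow> y \<le> x \<Longrightarrow> x \<le> 1 \<Longrightarrow> y \<in> J j"
    and meet: "\<And>i j. i \<in> P \<Longrightarrow> j \<in> Q \<Longrightarrow> \<exists>x. 0 \<le> x \<and> x \<le> 1 \<and> x \<in> I i \<and> x \<in> J j"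
    and ne: "P \<noteq> {}" "Q \<noteq> {}"
  shows "\<exists>x. 0 \<le> x \<and> x \<le> 1 \<and> (\<forall>i\<in>P. x \<in> I i) \<and> (\<forall>j\<in>Q. x \<in> J j)"
proof -
  define a where "a i = Inf (I i \<inter> {0..1})" for i
  have a: "a i \<in> I i \<inter> {0..1}" if i: "i \<in> P" for i
    unfolding a_def
  proof (rule closed_contains_Inf)
    show "I i \<inter> {0..1} \<noteq> {}" using meet[OF i] ne(2) by fastforce
    show "bdd_below (I i \<inter> {0..1})" by (rule bdd_belowI[of _ 0]) auto
    show "closed (I i \<inter> {0..1})" using clI[OF i] by blast
  qed
  have a_le: "a i \<le> x" if "0 \<le> x" "x \<le> 1" "x \<in> I i" for i x
    unfolding a_def by (rule cInf_lower) (use that in \<open>auto intro: bdd_belowI[of _ 0]\<close>)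
  let ?s = "Sup (a ` P)"
  have bdd: "bdd_above (a ` P)" using a by (intro bdd_aboveI[of _ 1]) auto
  have ge: "a i \<le> ?s" if "i \<in> P" for i using that bdd by (intro cSup_upper) auto
  have le1: "?s \<le> 1" using a ne(1) by (intro cSup_least) auto
  have ge0: "0 \<le> ?s" using a ge ne(1) by (metis IntE all_not_in_conv atLeastAtMost_iff order_trans)
  have "?s \<in> I i" if "i \<in> P" for i using up[OF that _ _ ge[OF that] le1] a[OF that] by auto
  moreover have "?s \<in> J j" if j: "j \<in> Q" for j
  proof (rule closed_subset_contains_Sup[OF clJ[OF j] _ _ bdd])
    show "a ` P \<subseteq> J j"
    proof clarify
      fix i assume i: "i \<in> P"
      obtain x where x: "0 \<le> x" "x \<le> 1" "x \<in> I i" "x \<in> J j" using meet[OF i j] by blast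
      show "a i \<in> J j" using down[OF j x(4) _ a_le[OF x(1-3)] x(2)] a[OF i] by auto
    qed
    show "a ` P \<noteq> {}" using ne by simp
  qed
  ultimately show ?thesis using ge0 le1 by blast
qed

text \<open>Consider the corner in the quadrant of \<open>c = (s, t)\<close>. The other corners
  force the functional there to have the corner's signs, so \<open>f * s\<close> and
  \<open>g * t\<close> are nonnegative, while the reflected opposite corner makes their sum
  nonpositive. So both vanish; if \<open>s\<close> is not 0 then \<open>f\<close> is, and the
  functional confines \<open>p\<close> to the horizontal strip. Likewise for \<open>t\<close> and
  \<open>q\<close>.\<close>

lemma center_of_supported_rectangle:
  fixes S :: "(real \<times> real) set"
  assumes corners: "{1, -1} \<times> {1, -1} \<subseteq> S"
    and supp: "\<And>x. x \<in> S \<Longrightarrow> \<exists>f. f \<noteq> 0 \<and> (\<forall>y\<in>S. f \<bullet> y \<le> f \<bullet> x \<and> f \<bullet> (2 *\<^sub>R c - y) \<le> f \<bullet> x)"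
    and p: "p \<in> S" "\<bar>snd p\<bar> > 1" and q: "q \<in> S" "\<bar>fst q\<bar> > 1"
  shows "c = 0"
proof -
  obtain s t where c: "c = (s, t)" by (cases c)
  have corner: "\<exists>f g. (f \<noteq> 0 \<or> g \<noteq> 0) \<and> \<sigma> * f \<ge> 0 \<and> \<tau> * g \<ge> 0 \<and> f * s + g * t \<le> 0 \<and>
      (\<forall>z\<in>S. f * fst z + g * snd z \<le> \<sigma> * f + \<tau> * g \<and>
              f * (2 * s - fst z) + g * (2 * t - snd z) \<le> \<sigma> * f + \<tau> * g)"
    if st: "\<sigma> \<in> {1, -1}" "\<tau> \<in> {1, -1}" for \<sigma> \<tau>
  proof -
    have "(\<sigma>, \<tau>) \<in> S" using corners st by auto
    from supp[OF this] obtain f g where fg: "(f, g) \<noteq> (0, 0)"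
      and z: "\<forall>z\<in>S. (f, g) \<bullet> z \<le> (f, g) \<bullet> (\<sigma>, \<tau>) \<and> (f, g) \<bullet> (2 *\<^sub>R c - z) \<le> (f, g) \<bullet> (\<sigma>, \<tau>)"
      by (metis surj_pair zero_prod_def)
    have z': "f * fst z + g * snd z \<le> \<sigma> * f + \<tau> * g \<and>
              f * (2 * s - fst z) + g * (2 * t - snd z) \<le> \<sigma> * f + \<tau> * g" if "z \<in> S" for z
      using z[rule_format, OF that] by (simp add: c inner_prod_def mult.commute)
    have "(-\<sigma>, \<tau>) \<in> S" "(\<sigma>, -\<tau>) \<in> S" "(-\<sigma>, -\<tau>) \<in> S" using corners st by auto
    from this[THEN z'] have "\<sigma> * f \<ge> 0" "\<tau> * g \<ge> 0" "f * s + g * t \<le> 0"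
      by (auto simp: algebra_simps)
    then show ?thesis using fg z' by blast
  qed
  define \<sigma> where "\<sigma> = (if s \<ge> 0 then 1 else -1 :: real)"
  define \<tau> where "\<tau> = (if t \<ge> 0 then 1 else -1 :: real)"
  have "\<sigma> \<in> {1, -1}" "\<tau> \<in> {1, -1}" by (auto simp: \<sigma>_def \<tau>_def)
  from corner[OF this] obtain f g where fg: "f \<noteq> 0 \<or> g \<noteq> 0" "\<sigma> * f \<ge> 0" "\<tau> * g \<ge> 0"
    and le0: "f * s + g * t \<le> 0"
    and z: "\<And>z. z \<in> S \<Longrightarrow> f * fst z + g * snd z \<le> \<sigma> * f + \<tau> * g \<and>
              f * (2 * s - fst z) + g * (2 * t - snd z) \<le> \<sigma> * f + \<tau> * g" by blast
  have nonneg: "f * s \<ge> 0" "g * t \<ge> 0"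
    using fg by (cases "s \<ge> 0"; cases "t \<ge> 0"; simp add: \<sigma>_def \<tau>_def mult_nonpos_nonpos)+
  have zero: "f * s = 0" "g * t = 0" using nonneg le0 by linarith+
  have absf: "\<sigma> * f = \<bar>f\<bar>" "\<tau> * g = \<bar>g\<bar>" using fg by (auto simp: \<sigma>_def \<tau>_def split: if_splits)
  have bound: "\<bar>f * fst z + g * snd z\<bar> \<le> \<bar>f\<bar> + \<bar>g\<bar>" if "z \<in> S" for z
  proof -
    have "f * (2 * s - fst z) + g * (2 * t - snd z) = - (f * fst z + g * snd z)"
      using zero by (auto simp: right_diff_distrib)
    then show ?thesis using z[OF that] unfolding absf abs_le_iff by linarith
  qed
  have "s = 0"
  proof (rule ccontr)
    assume "s \<noteq> 0"
    then have "f = 0" "g \<noteq> 0" using zero fg by auto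
    then have "\<bar>g\<bar> * \<bar>snd p\<bar> \<le> \<bar>g\<bar> * 1" using bound[OF p(1)] by (simp add: abs_mult)
    then show False using p(2) \<open>g \<noteq> 0\<close> by simp
  qed
  moreover have "t = 0"
  proof (rule ccontr)
    assume "t \<noteq> 0"
    then have "g = 0" "f \<noteq> 0" using zero fg by auto
    then have "\<bar>f\<bar> * \<bar>fst q\<bar> \<le> \<bar>f\<bar> * 1" using bound[OF q(1)] by (simp add: abs_mult)
    then show False using q(2) \<open>f \<noteq> 0\<close> by simp
  qed
  ultimately show ?thesis by (simp add: c zero_prod_def)
qed

text \<open>The six points are the corners, \<open>p\<close> and \<open>q\<close>. Their centre must
  be the origin, so the functional at the corner \<open>(\<sigma>, 1)\<close> bounds absolute
  values; dividing by the sum of its weights, which are nonnegative up to the sign \<sigma>, gives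
  the form with \<theta>.\<close>

lemma rectangle_pair_support:
  fixes G :: "(real \<times> real) set"
  assumes corners: "{1, -1} \<times> {1, -1} \<subseteq> G"
    and six: "\<And>S. finite S \<Longrightarrow> card S \<le> 6 \<Longrightarrow> S \<subseteq> G \<Longrightarrow> centrally_supported S"
    and p: "p \<in> G" "\<bar>snd p\<bar> > 1" and q: "q \<in> G" "\<bar>fst q\<bar> > 1"
    and \<sigma>: "\<sigma> \<in> {1, -1 :: real}"
  shows "\<exists>\<theta>. 0 \<le> \<theta> \<and> \<theta> \<le> 1 \<and> \<bar>\<theta> * \<sigma> * fst p + (1 - \<theta>) * snd p\<bar> \<le> 1
            \<and> \<bar>\<theta> * \<sigma> * fst q + (1 - \<theta>) * snd q\<bar> \<le> 1"
proof -
  let ?C = "{1, -1} \<times> {1, -1 :: real}"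
  let ?S = "?C \<union> {p, q}"
  have "?S = set [(1,1), (1,-1), (-1,1), (-1,-1), p, q]" by auto
  then have "card ?S \<le> 6" using card_length[of "[(1,1), (1,-1), (-1,1), (-1,-1), p, q]"] by simp
  then have "centrally_supported ?S" by (intro six) (use corners p q in auto)
  then obtain c where c: "\<And>x. x \<in> ?S \<Longrightarrow>
      \<exists>f. f \<noteq> 0 \<and> (\<forall>y\<in>?S. f \<bullet> y \<le> f \<bullet> x \<and> f \<bullet> (2 *\<^sub>R c - y) \<le> f \<bullet> x)"
    unfolding centrally_supported_def by blast
  have c0: "c = 0" by (rule center_of_supported_rectangle[OF _ c, of p q]) (use p q in auto)
  have "(\<sigma>, 1) \<in> ?S" using \<sigma> by auto
  from c[OF this] obtain f g where fg: "(f, g) \<noteq> (0, 0)"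
    and z: "\<forall>z\<in>?S. (f, g) \<bullet> z \<le> (f, g) \<bullet> (\<sigma>, 1) \<and> (f, g) \<bullet> (2 *\<^sub>R c - z) \<le> (f, g) \<bullet> (\<sigma>, 1)"
    by (metis surj_pair zero_prod_def)
  have z': "\<bar>f * fst z + g * snd z\<bar> \<le> \<sigma> * f + g" if "z \<in> ?S" for z
    using z[rule_format, OF that] by (simp add: c0 inner_prod_def mult.commute abs_le_iff)
  have "(-\<sigma>, 1) \<in> ?S" "(\<sigma>, -1) \<in> ?S" using \<sigma> by auto
  from this[THEN z'] have nn: "\<sigma> * f \<ge> 0" "g \<ge> 0" by (auto simp: algebra_simps)
  define h where "h = \<sigma> * f"
  have ff: "f = \<sigma> * h" using \<sigma> by (auto simp: h_def)
  have "h \<noteq> 0 \<or> g \<noteq> 0" using fg ff by auto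
  then have pos: "h + g > 0" using nn unfolding h_def[symmetric] by linarith
  define \<theta> where "\<theta> = h / (h + g)"
  have \<theta>1: "1 - \<theta> = g / (h + g)" using pos by (simp add: \<theta>_def field_simps)
  have "\<bar>\<theta> * \<sigma> * fst z + (1 - \<theta>) * snd z\<bar> \<le> 1" if "z \<in> ?S" for z
  proof -
    have "\<theta> * \<sigma> * fst z + (1 - \<theta>) * snd z = (f * fst z + g * snd z) / (h + g)"
      unfolding \<theta>1 by (simp add: \<theta>_def ff add_divide_distrib mult.commute)
    then show ?thesis using z'[OF that] pos by (simp add: h_def abs_divide divide_le_eq)
  qed
  moreover have "0 \<le> \<theta>" "\<theta> \<le> 1" using nn pos by (auto simp: \<theta>_def h_def divide_le_eq)
  ultimately show ?thesis by blast
qed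

text \<open>This is one functional for all of \<open>G\<close>, supporting it at
  \<open>(\<sigma>, 1)\<close> and at the opposite corner. Points in both strips obey every weight
  \<theta> between 0 and 1; for the others Helly's theorem merges the pairwise weights.\<close>

lemma rectangle_support:
  fixes G :: "(real \<times> real) set"
  assumes corners: "{1, -1} \<times> {1, -1} \<subseteq> G"
    and six: "\<And>S. finite S \<Longrightarrow> card S \<le> 6 \<Longrightarrow> S \<subseteq> G \<Longrightarrow> centrally_supported S"
    and p: "p \<in> G" "\<bar>snd p\<bar> > 1" and q: "q \<in> G" "\<bar>fst q\<bar> > 1"
    and \<sigma>: "\<sigma> \<in> {1, -1 :: real}"
  obtains \<kappa> where "\<kappa> > 0" "\<And>z. z \<in> G \<Longrightarrow> \<bar>\<sigma> * \<kappa> * fst z + snd z\<bar> \<le> 1 + \<kappa>"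
proof -
  note pair = rectangle_pair_support[OF corners six]
  \<comment> \<open>With \<open>z\<close> in the role of both \<open>p\<close> and \<open>q\<close>,
    and the sign \<tau> for which the terms cannot cancel, the absolute value of the functional is a
    weighted mean of two numbers above 1.\<close>
  have not_both: "\<bar>fst z\<bar> \<le> 1 \<or> \<bar>snd z\<bar> \<le> 1" if z: "z \<in> G" for z
  proof (rule ccontr)
    assume "\<not> ?thesis"
    then have big: "\<bar>snd z\<bar> > 1" "\<bar>fst z\<bar> > 1" by auto
    define \<tau> where "\<tau> = (if (fst z \<ge> 0) = (snd z \<ge> 0) then 1 else -1 :: real)"
    have "\<tau> \<in> {1, -1}" by (simp add: \<tau>_def)
    from pair[OF _ _ _ z big(1) z big(2) this] obtain \<theta> where \<theta>: "0 \<le> \<theta>" "\<theta> \<le> 1"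
      and le: "\<bar>\<theta> * \<tau> * fst z + (1 - \<theta>) * snd z\<bar> \<le> 1" by blast
    define m where "m = min \<bar>fst z\<bar> \<bar>snd z\<bar>"
    have "\<bar>\<theta> * \<tau> * fst z + (1 - \<theta>) * snd z\<bar> = \<theta> * \<bar>fst z\<bar> + (1 - \<theta>) * \<bar>snd z\<bar>"
    proof (cases "snd z \<ge> 0")
      case True
      then have "\<tau> * fst z = \<bar>fst z\<bar>" by (auto simp: \<tau>_def)
      then show ?thesis using True \<theta> by (simp add: mult.assoc)
    next
      case False
      then have "\<tau> * fst z = - \<bar>fst z\<bar>" by (auto simp: \<tau>_def)
      then have "\<theta> * \<tau> * fst z + (1 - \<theta>) * snd z = - (\<theta> * \<bar>fst z\<bar> + (1 - \<theta>) * \<bar>snd z\<bar>)"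
        using False by (simp add: mult.assoc)
      moreover have "\<theta> * \<bar>fst z\<bar> \<ge> 0" "(1 - \<theta>) * \<bar>snd z\<bar> \<ge> 0" using \<theta> by auto
      ultimately show ?thesis by linarith
    qed
    moreover have "\<theta> * m + (1 - \<theta>) * m \<le> \<theta> * \<bar>fst z\<bar> + (1 - \<theta>) * \<bar>snd z\<bar>"
      using \<theta> by (intro add_mono mult_left_mono) (auto simp: m_def)
    moreover have "\<theta> * m + (1 - \<theta>) * m = m" by (simp add: algebra_simps)
    moreover have "m > 1" using big by (simp add: m_def)
    ultimately show False using le by linarith
  qed
  \<comment> \<open>\<open>I z\<close> is an interval ending at 1 for \<open>z \<in> P\<close> and starting at 0 for \<open>z \<in> Q\<close>, so only
      the pairs in \<open>P \<times> Q\<close>, covered by six points, matter for Helly's theorem.\<close>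
  define P where "P = {z \<in> G. \<bar>snd z\<bar> > 1}"
  define Q where "Q = {z \<in> G. \<bar>fst z\<bar> > 1}"
  define I where "I z = {\<theta>. \<bar>\<theta> * \<sigma> * fst z + (1 - \<theta>) * snd z\<bar> \<le> 1}" for z
  have pq: "p \<in> P" "q \<in> Q" using p q by (simp_all add: P_def Q_def)
  have s1: "\<bar>\<sigma> * a\<bar> = \<bar>a\<bar>" for a using \<sigma> by auto
  have cl: "closed (I z)" for z unfolding I_def
    by (intro closed_Collect_le continuous_intros)
  have cvx: "convex (I z)" for z
  proof -
    have "I z = (\<lambda>\<theta>. \<theta> *\<^sub>R (\<sigma> * fst z - snd z)) -` cball (- snd z) 1"
      by (auto simp: I_def dist_norm algebra_simps)
    moreover have "linear (\<lambda>\<theta>::real. \<theta> *\<^sub>R (\<sigma> * fst z - snd z))"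
      by (simp add: linear_iff algebra_simps)
    ultimately show ?thesis by (simp add: convex_linear_vimage)
  qed
  have "\<exists>x. 0 \<le> x \<and> x \<le> 1 \<and> (\<forall>i\<in>P. x \<in> I i) \<and> (\<forall>j\<in>Q. x \<in> I j)"
  proof (rule common_point_of_up_and_down_closed)
    fix z x y assume z: "z \<in> P" and x: "x \<in> I z" "x \<le> y" "y \<le> 1"
    have "\<bar>fst z\<bar> \<le> 1" using not_both[of z] z by (auto simp: P_def)
    then have "1 \<in> I z" by (simp add: I_def s1)
    with cvx[of z] x show "y \<in> I z"
      by (metis is_interval_1 is_interval_convex_1)
  next
    fix z x y assume z: "z \<in> Q" and x: "x \<in> I z" "0 \<le> y" "y \<le> x"
    have "\<bar>snd z\<bar> \<le> 1" using not_both[of z] z by (auto simp: Q_def)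
    then have "0 \<in> I z" by (simp add: I_def)
    with cvx[of z] x show "y \<in> I z"
      by (metis is_interval_1 is_interval_convex_1)
  next
    fix y z assume "y \<in> P" "z \<in> Q"
    then show "\<exists>x. 0 \<le> x \<and> x \<le> 1 \<and> x \<in> I y \<and> x \<in> I z"
      using pair[of y z \<sigma>] \<sigma> by (auto simp: P_def Q_def I_def)
  qed (use cl pq in blast)+
  then obtain \<theta> where \<theta>: "0 \<le> \<theta>" "\<theta> \<le> 1" "\<forall>z\<in>P. \<theta> \<in> I z" "\<forall>z\<in>Q. \<theta> \<in> I z" by blast
  \<comment> \<open>Weight 0 would confine \<open>p\<close> to its strip and weight 1 would confine
    \<open>q\<close>, so it is possible to divide by \<open>1 - \<theta>\<close>.\<close>
  have "\<theta> \<in> I p" "\<theta> \<in> I q" using \<theta> pq by blast+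
  then have "\<theta> \<noteq> 0" "\<theta> \<noteq> 1" using p(2) q(2) by (auto simp: I_def s1)
  then have \<theta>01: "0 < \<theta>" "\<theta> < 1" using \<theta> by auto
  have all: "\<bar>\<theta> * \<sigma> * fst z + (1 - \<theta>) * snd z\<bar> \<le> 1" if "z \<in> G" for z
  proof (cases "z \<in> P \<union> Q")
    case True
    then show ?thesis using \<theta> by (auto simp: I_def)
  next
    case False
    then have "\<bar>fst z\<bar> \<le> 1" "\<bar>snd z\<bar> \<le> 1" using that by (auto simp: P_def Q_def)
    then have "\<bar>\<theta> * (\<sigma> * fst z)\<bar> \<le> \<theta> * 1" "\<bar>(1 - \<theta>) * snd z\<bar> \<le> (1 - \<theta>) * 1"
      unfolding abs_mult using \<theta>01 s1[of "fst z"] by (auto simp: abs_mult)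
    then show ?thesis by (simp add: mult.assoc)
  qed
  show ?thesis
  proof (rule that[of "\<theta> / (1 - \<theta>)"])
    show "\<theta> / (1 - \<theta>) > 0" using \<theta>01 by simp
    fix z assume "z \<in> G"
    have e: "\<sigma> * (\<theta> / (1 - \<theta>)) * fst z + snd z = (\<theta> * \<sigma> * fst z + (1 - \<theta>) * snd z) / (1 - \<theta>)"
      "1 + \<theta> / (1 - \<theta>) = 1 / (1 - \<theta>)"
      using \<theta>01 by (auto simp: field_simps)
    show "\<bar>\<sigma> * (\<theta> / (1 - \<theta>)) * fst z + snd z\<bar> \<le> 1 + \<theta> / (1 - \<theta>)"
      unfolding e abs_divide using all[OF \<open>z \<in> G\<close>] \<theta>01 by (simp add: divide_right_mono)
  qed
qed

text \<open>An affine map takes the square to the parallelogram; \<open>topbot\<close> and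
  \<open>side\<close> supply the points outside the two strips. The functionals at the corners (1,
  1) and (-1, 1) become lines of slopes \<open>n\<close> and \<open>m\<close> through the upper
  right and upper left vertices, with parallels through the opposite vertices.\<close>

lemma parallelogram_slopes:
  fixes G :: "(real \<times> real) set"
  assumes six: "\<And>S. finite S \<Longrightarrow> card S \<le> 6 \<Longrightarrow> S \<subseteq> G \<Longrightarrow> centrally_supported S"
    and vert: "(x1, y1) \<in> G" "(x1, y1 - l) \<in> G" "(x2, y2) \<in> G" "(x2, y2 - l) \<in> G"
    and x12: "x1 < x2" and l: "l > 0"
    and side: "\<exists>z\<in>G. fst z < x1"
    and topbot: "\<exists>z\<in>G. snd z > y1 + (y2 - y1) / (x2 - x1) * (fst z - x1) \<or>
                        snd z < y1 - l + (y2 - y1) / (x2 - x1) * (fst z - x1)"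
  obtains m n where "n < m"
    "\<And>x y. (x, y) \<in> G \<Longrightarrow> y - m * x \<le> y1 - m * x1 \<and> y2 - l - m * x2 \<le> y - m * x"
    "\<And>x y. (x, y) \<in> G \<Longrightarrow> y - n * x \<le> y2 - n * x2 \<and> y1 - l - n * x1 \<le> y - n * x"
proof -
  \<comment> \<open>Half the width, half the rise and half the height: the map \<open>T\<close>
    below sends (1, 0) to \<open>(U, W)\<close> and (0, 1) to \<open>(0, V)\<close>.\<close>
  define U W V where uvw: "U = (x2 - x1) / 2" "W = (y2 - y1) / 2" "V = l / 2"
  have U: "U > 0" and V: "V > 0" using x12 l by (auto simp: uvw)
  define o1 o2 where o12: "o1 = (x1 + x2) / 2" "o2 = (y1 + y2 - l) / 2"
  have ends: "x1 = o1 - U" "x2 = o1 + U" "y1 = o2 - W + V" "y2 = o2 + W + V" "l = 2 * V"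
    by (auto simp: o12 uvw field_simps)
  define T :: "real \<times> real \<Rightarrow> real \<times> real" where "T z = (U * fst z, W * fst z + V * snd z)" for z
  have linT: "linear T" by (auto simp: linear_iff T_def algebra_simps)
  have inv: "(o1, o2) + T ((x - o1) / U, (y - o2 - W * ((x - o1) / U)) / V) = (x, y)" for x y
    using U V by (simp add: T_def field_simps)
  have surT: "surj T"
  proof (rule surjI)
    fix z show "T ((fst z) / U, (snd z - W * ((fst z) / U)) / V) = z"
      using U V by (cases z) (simp add: T_def field_simps)
  qed
  define G0 where "G0 = {z. (o1, o2) + T z \<in> G}"
  have six0: "centrally_supported S" if "finite S" "card S \<le> 6" "S \<subseteq> G0" for S
  proof (rule centrally_supported_affine_vimage[OF linT surT, of "(o1, o2)"], rule six)
    show "card ((\<lambda>x. (o1, o2) + T x) ` S) \<le> 6" using that(1,2) card_image_le order_trans by blast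
  qed (use that in \<open>auto simp: G0_def\<close>)
  have corners: "{1, -1} \<times> {1, -1} \<subseteq> G0"
  proof -
    have "(o1, o2) + T (1, 1) = (x2, y2)" "(o1, o2) + T (1, -1) = (x2, y2 - l)"
      "(o1, o2) + T (-1, 1) = (x1, y1)" "(o1, o2) + T (-1, -1) = (x1, y1 - l)"
      by (auto simp: T_def o12 uvw field_simps)
    then show ?thesis using vert by (auto simp: G0_def)
  qed
  define N where "N x y = ((x - o1) / U, (y - o2 - W * ((x - o1) / U)) / V)" for x y
  have N: "N x y \<in> G0 \<longleftrightarrow> (x, y) \<in> G" for x y
    unfolding G0_def N_def using inv by simp
  obtain q where q: "q \<in> G0" "\<bar>fst q\<bar> > 1"
  proof -
    from side obtain a b where ab: "(a, b) \<in> G" "a < x1" by auto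
    have "fst (N a b) < -1" using ab U by (simp add: N_def o12 uvw field_simps)
    with ab N[of a b] that[of "N a b"] show ?thesis by auto
  qed
  obtain p where p: "p \<in> G0" "\<bar>snd p\<bar> > 1"
  proof -
    from topbot obtain a b where ab: "(a, b) \<in> G"
      "b > y1 + (y2 - y1) / (x2 - x1) * (a - x1) \<or> b < y1 - l + (y2 - y1) / (x2 - x1) * (a - x1)"
      by auto
    have "y2 - y1 = 2 * W" "x2 - x1 = 2 * U" by (simp_all add: uvw)
    then have w: "(y2 - y1) / (x2 - x1) = W / U" by simp
    have "W / U * (a - x1) = W * ((a - o1) / U) + W"
      using U by (simp add: ends(1) field_simps)
    then have "b - o2 - W * ((a - o1) / U) > V \<or> b - o2 - W * ((a - o1) / U) < - V"
      using ab(2) ends(3,5) unfolding w by linarith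
    then have "snd (N a b) > 1 \<or> snd (N a b) < -1"
      using V by (simp add: N_def less_divide_eq divide_less_eq)
    with ab N[of a b] that[of "N a b"] show ?thesis by auto
  qed
  note rs = rectangle_support[OF corners six0 p q]
  obtain \<kappa> where \<kappa>: "\<kappa> > 0" "\<And>z. z \<in> G0 \<Longrightarrow> \<bar>1 * \<kappa> * fst z + snd z\<bar> \<le> 1 + \<kappa>"
    using rs[of 1] by auto
  obtain \<mu> where \<mu>: "\<mu> > 0" "\<And>z. z \<in> G0 \<Longrightarrow> \<bar>-1 * \<mu> * fst z + snd z\<bar> \<le> 1 + \<mu>"
    using rs[of "-1"] by auto
  have conv: "\<bar>y - o2 - (W - r * V) / U * (x - o1)\<bar> \<le> V + k * V"
    if "(x, y) \<in> G" "\<And>z. z \<in> G0 \<Longrightarrow> \<bar>r * fst z + snd z\<bar> \<le> 1 + k" for r k x y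
  proof -
    have "\<bar>r * fst (N x y) + snd (N x y)\<bar> \<le> 1 + k" using that N by blast
    then have "\<bar>(r * fst (N x y) + snd (N x y)) * V\<bar> \<le> (1 + k) * V" using V by (simp add: abs_mult)
    moreover have "(r * fst (N x y) + snd (N x y)) * V = y - o2 - (W - r * V) / U * (x - o1)"
      using U V by (simp add: N_def field_simps)
    ultimately show ?thesis by (simp add: distrib_right)
  qed
  show ?thesis
  \<comment> \<open>The smaller slope \<open>n\<close> is instantiated first; it belongs to the sign
    1, and \<open>m\<close> to the sign -1.\<close>
  proof (rule that[of "(W - \<kappa> * V) / U" "(W - (- \<mu>) * V) / U"])
    show "(W - \<kappa> * V) / U < (W - (- \<mu>) * V) / U"
      using \<kappa>(1) \<mu>(1) U V by (intro divide_strict_right_mono) (auto intro: add_pos_pos simp: algebra_simps)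
    fix x y assume G: "(x, y) \<in> G"
    have k: "\<bar>y - o2 - (W - \<kappa> * V) / U * (x - o1)\<bar> \<le> V + \<kappa> * V"
      using conv[OF G, of \<kappa> \<kappa>] \<kappa>(2) by simp
    have m: "\<bar>y - o2 - (W - (- \<mu>) * V) / U * (x - o1)\<bar> \<le> V + \<mu> * V"
      using conv[OF G, of "- \<mu>" \<mu>] \<mu>(2) by simp
    have r: "r / U * (o1 - U) = r / U * o1 - r" "r / U * (o1 + U) = r / U * o1 + r" for r
      using U by (auto simp: field_simps)
    show "y - (W - (- \<mu>) * V) / U * x \<le> y1 - (W - (- \<mu>) * V) / U * x1 \<and>
       y2 - l - (W - (- \<mu>) * V) / U * x2 \<le> y - (W - (- \<mu>) * V) / U * x"
      using m unfolding ends r by (simp add: right_diff_distrib abs_le_iff)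
    show "y - (W - \<kappa> * V) / U * x \<le> y2 - (W - \<kappa> * V) / U * x2 \<and>
       y1 - l - (W - \<kappa> * V) / U * x1 \<le> y - (W - \<kappa> * V) / U * x"
      using k unfolding ends r by (simp add: right_diff_distrib abs_le_iff)
  qed
qed

subsection \<open>Constancy of the centre\<close>

text \<open>Over \<open>n\<close> equal steps of length \<open>h\<close> the bounds telescope to
  \<open>(M B - M A) * h\<close>, which tends to 0 as \<open>n\<close> grows.\<close>

lemma constant_if_square_small:
  fixes c M :: "real \<Rightarrow> real"
  assumes AB: "A \<le> B"
    and small: "\<And>s t. A \<le> s \<Longrightarrow> s \<le> t \<Longrightarrow> t \<le> B \<Longrightarrow> \<bar>c t - c s\<bar> \<le> (M t - M s) * (t - s)"
  shows "c A = c B"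
proof (rule ccontr)
  assume "c A \<noteq> c B"
  then have pos: "0 < \<bar>c B - c A\<bar>" by simp
  obtain n :: nat where n: "(M B - M A) * (B - A) < real n * \<bar>c B - c A\<bar>"
    using reals_Archimedean3[OF pos] by blast
  have "0 \<le> (M B - M A) * (B - A)" using small[of A B] AB by simp
  then have n0: "n > 0" using n by (cases n) auto
  define h where "h = (B - A) / real n"
  have h: "h \<ge> 0" "real n * h = B - A" using AB n0 by (auto simp: h_def)
  have "\<bar>c (A + real k * h) - c A\<bar> \<le> (M (A + real k * h) - M A) * h" if "k \<le> n" for k
    using that
  proof (induction k)
    case (Suc k)
    have "real (Suc k) * h \<le> real n * h" using Suc.prems h by (intro mult_right_mono) auto
    then have "\<bar>c (A + real (Suc k) * h) - c (A + real k * h)\<bar>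
        \<le> (M (A + real (Suc k) * h) - M (A + real k * h)) * h"
      using small[of "A + real k * h" "A + real (Suc k) * h"] h by (simp add: algebra_simps)
    with Suc show ?case by (simp add: left_diff_distrib)
  qed simp
  from this[of n] have "\<bar>c B - c A\<bar> \<le> (M B - M A) * h" using h by simp
  then have "real n * \<bar>c B - c A\<bar> \<le> (M B - M A) * (B - A)"
    using n0 h by (simp add: mult.left_commute[of "real n"] flip: h(2))
  with n show False by simp
qed

text \<open>The points \<open>(X1 l, Y1 l)\<close> and \<open>(X2 l, Y2 l)\<close> are the upper
  ends of two chords of length \<open>l\<close>; \<open>m l\<close> and \<open>n l\<close> are the
  slopes of supporting lines at the ends of the diagonals. Testing the lines for one length on the
  vertices for another shows that the chords approach each other at a bounded rate, while
  \<open>m\<close> falls and \<open>n\<close> rises. This bounds the motion of the centre as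
  \<open>constant_if_square_small\<close> requires: first for the abscissa, then with its help for
  the ordinate.\<close>

lemma center_constant:
  fixes X1 Y1 X2 Y2 m n :: "real \<Rightarrow> real"
  assumes AB: "A \<le> B"
    and nm: "\<And>l. A \<le> l \<Longrightarrow> l \<le> B \<Longrightarrow> n l < m l"
    and s1: "\<And>l k. A \<le> l \<Longrightarrow> l \<le> B \<Longrightarrow> A \<le> k \<Longrightarrow> k \<le> B \<Longrightarrow> Y1 k - m l * X1 k \<le> Y1 l - m l * X1 l"
    and s2: "\<And>l k. A \<le> l \<Longrightarrow> l \<le> B \<Longrightarrow> A \<le> k \<Longrightarrow> k \<le> B \<Longrightarrow> Y2 l - l - m l * X2 l \<le> Y2 k - k - m l * X2 k"
    and s3: "\<And>l k. A \<le> l \<Longrightarrow> l \<le> B \<Longrightarrow> A \<le> k \<Longrightarrow> k \<le> B \<Longrightarrow> Y2 k - n l * X2 k \<le> Y2 l - n l * X2 l"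
    and s4: "\<And>l k. A \<le> l \<Longrightarrow> l \<le> B \<Longrightarrow> A \<le> k \<Longrightarrow> k \<le> B \<Longrightarrow> Y1 l - l - n l * X1 l \<le> Y1 k - k - n l * X1 k"
  shows "X1 A + X2 A = X1 B + X2 B" "Y1 A + Y2 A - A = Y1 B + Y2 B - B"
proof -
  define \<delta> where "\<delta> = m B - n B"
  have \<delta>: "\<delta> > 0" using nm[of B] AB by (simp add: \<delta>_def)
  have basic: "X1 t - X1 s \<ge> 0 \<and> X2 t - X2 s \<le> 0 \<and> m t \<le> m s \<and> n s \<le> n t
      \<and> (m t - n t) * (X1 t - X1 s) \<le> t - s \<and> (m t - n t) * (X2 s - X2 t) \<le> t - s
      \<and> m t * (X1 t - X1 s) \<le> Y1 t - Y1 s \<and> Y1 t - Y1 s \<le> m s * (X1 t - X1 s)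
      \<and> m s * (X2 t - X2 s) \<le> Y2 t - Y2 s - (t - s) \<and> Y2 t - Y2 s - (t - s) \<le> m t * (X2 t - X2 s)
      \<and> n t * (X2 t - X2 s) \<le> Y2 t - Y2 s \<and> Y2 t - Y2 s \<le> n s * (X2 t - X2 s)
      \<and> n s * (X1 t - X1 s) \<le> Y1 t - Y1 s - (t - s) \<and> Y1 t - Y1 s - (t - s) \<le> n t * (X1 t - X1 s)"
    if st: "A \<le> s" "s < t" "t \<le> B" for s t
  proof -
    have i: "A \<le> s" "s \<le> B" "A \<le> t" "t \<le> B" using st by auto
    define a b where ab: "a = X1 t - X1 s" "b = X2 t - X2 s"
    have 1: "m t * a \<le> Y1 t - Y1 s" "Y1 t - Y1 s \<le> m s * a"
      using s1[OF i(3,4,1,2)] s1[OF i] by (auto simp: ab algebra_simps)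
    have 2: "m s * b \<le> Y2 t - Y2 s - (t - s)" "Y2 t - Y2 s - (t - s) \<le> m t * b"
      using s2[OF i(3,4,1,2)] s2[OF i] by (auto simp: ab algebra_simps)
    have 3: "n t * b \<le> Y2 t - Y2 s" "Y2 t - Y2 s \<le> n s * b"
      using s3[OF i(3,4,1,2)] s3[OF i] by (auto simp: ab algebra_simps)
    have 4: "n s * a \<le> Y1 t - Y1 s - (t - s)" "Y1 t - Y1 s - (t - s) \<le> n t * a"
      using s4[OF i(3,4,1,2)] s4[OF i] by (auto simp: ab algebra_simps)
    have gap: "m s - n s > 0" using nm[OF i(1,2)] by simp
    \<comment> \<open>The increment of \<open>Y1\<close> is at most \<open>m s * a\<close> and at
      least \<open>n s * a + (t - s)\<close>, so the left chord moves to the right.\<close>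
    have "(m s - n s) * a \<ge> t - s" using 1 4 by (simp add: left_diff_distrib)
    then have a0: "a > 0" using gap st(2) zero_less_mult_pos[of "m s - n s" a] by linarith
    have "(m s - n s) * (- b) \<ge> t - s" using 2 3 by (simp add: algebra_simps)
    then have b0: "- b > 0" using gap st(2) zero_less_mult_pos[of "m s - n s" "- b"] by linarith
    have "m t * a \<le> m s * a" using 1 by linarith
    then have mts: "m t \<le> m s" using a0 by simp
    have "n s * (- b) \<le> n t * (- b)" using 3 by simp
    then have nts: "n s \<le> n t" using b0 by (simp del: mult_minus_right)
    have "(m t - n t) * a \<le> t - s" using 1 4 by (simp add: left_diff_distrib)
    moreover have "(m t - n t) * (X2 s - X2 t) \<le> t - s"
    proof -
      have "(m t - n t) * (X2 s - X2 t) = n t * b - m t * b" by (simp add: ab algebra_simps)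
      then show ?thesis using 2 3 by linarith
    qed
    ultimately show ?thesis using a0 b0 mts nts 1 2 3 4 unfolding ab by auto
  qed
  \<comment> \<open>The difference of the slopes does not increase with the length, so its value at
    \<open>B\<close> is a lower bound throughout.\<close>
  have gap: "m t - n t \<ge> \<delta>" if "A \<le> t" "t \<le> B" for t
  proof (cases "t = B")
    case False
    then show ?thesis using basic[of t B] that by (auto simp: \<delta>_def)
  qed (simp add: \<delta>_def)
  have bounds: "X1 t - X1 s \<le> (t - s) / \<delta> \<and> X2 s - X2 t \<le> (t - s) / \<delta>"
    if st: "A \<le> s" "s < t" "t \<le> B" for s t
  proof -
    have g: "\<delta> \<le> m t - n t" using gap st by simp
    note b = basic[OF st]
    have "\<delta> * (X1 t - X1 s) \<le> (m t - n t) * (X1 t - X1 s)" using g b by (intro mult_right_mono) auto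
    moreover have "\<delta> * (X2 s - X2 t) \<le> (m t - n t) * (X2 s - X2 t)" using g b by (intro mult_right_mono) auto
    ultimately have "\<delta> * (X1 t - X1 s) \<le> t - s" "\<delta> * (X2 s - X2 t) \<le> t - s" using b by auto
    then show ?thesis using \<delta> by (simp add: field_simps)
  qed
  have est: "\<bar>(X1 t + X2 t) - (X1 s + X2 s)\<bar> \<le> ((n t - m t) / \<delta>\<^sup>2 - (n s - m s) / \<delta>\<^sup>2) * (t - s)
     \<and> \<bar>(Y1 t + Y2 t - t) - (Y1 s + Y2 s - s) - m t * ((X1 t + X2 t) - (X1 s + X2 s))\<bar>
        \<le> (- m t / \<delta> - (- m s / \<delta>)) * (t - s)"
    if st: "A \<le> s" "s \<le> t" "t \<le> B" for s t
  proof (cases "s = t")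
    case False
    then have st': "A \<le> s" "s < t" "t \<le> B" using st by auto
    define a b D where ab: "a = X1 t - X1 s" "b = X2 t - X2 s" and D: "D = (t - s) / \<delta>"
    define y where "y = (Y1 t + Y2 t - t) - (Y1 s + Y2 s - s)"
    note bs = basic[OF st'] and bd = bounds[OF st']
    have ab_D: "0 \<le> a" "a \<le> D" "0 \<le> - b" "- b \<le> D" using bs bd by (auto simp: ab D)
    have ms: "0 \<le> m s - m t" and ns: "0 \<le> n t - n s" using bs by auto
    \<comment> \<open>The increment \<open>y\<close> lies between combinations of \<open>a\<close>
      and \<open>b\<close> with slopes at \<open>s\<close> and \<open>t\<close>; replacing all
      slopes by the one at \<open>t\<close> costs at most the slope change times
      \<open>D\<close>.\<close>
    have y1: "y \<le> m s * a + m t * b" "m t * a + m s * b \<le> y"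
      using bs unfolding y_def ab by linarith+
    have y2: "y \<le> n t * a + n s * b" "n s * a + n t * b \<le> y"
      using bs unfolding y_def ab by linarith+
    have e1: "(m s - m t) * a \<le> (m s - m t) * D" "(m s - m t) * (- b) \<le> (m s - m t) * D"
      using mult_left_mono[OF ab_D(2) ms] mult_left_mono[OF ab_D(4) ms] by blast+
    have e2: "(n t - n s) * a \<le> (n t - n s) * D" "(n t - n s) * (- b) \<le> (n t - n s) * D"
      using mult_left_mono[OF ab_D(2) ns] mult_left_mono[OF ab_D(4) ns] by blast+
    have m1: "\<bar>y - m t * (a + b)\<bar> \<le> (m s - m t) * D"
      using y1 e1 unfolding abs_le_iff by (simp add: algebra_simps)
    have m2: "\<bar>y - n t * (a + b)\<bar> \<le> (n t - n s) * D"
      using y2 e2 unfolding abs_le_iff by (simp add: algebra_simps)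
    \<comment> \<open>Subtracting the two estimates eliminates \<open>y\<close> and leaves a bound
      for the increment \<open>a + b\<close> of the abscissa.\<close>
    have "(m t - n t) * (a + b) = (y - n t * (a + b)) - (y - m t * (a + b))" by (simp add: algebra_simps)
    then have "\<bar>(m t - n t) * (a + b)\<bar> \<le> (m s - m t) * D + (n t - n s) * D" using m1 m2 by linarith
    moreover have "(m s - m t) * D + (n t - n s) * D = ((n t - m t) - (n s - m s)) * D"
      by (simp add: algebra_simps)
    ultimately have "\<bar>m t - n t\<bar> * \<bar>a + b\<bar> \<le> ((n t - m t) - (n s - m s)) * D"
      unfolding abs_mult by linarith
    moreover have "\<delta> * \<bar>a + b\<bar> \<le> \<bar>m t - n t\<bar> * \<bar>a + b\<bar>"
      using gap[of t] st by (intro mult_right_mono) auto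
    ultimately have "\<delta> * \<bar>a + b\<bar> \<le> ((n t - m t) - (n s - m s)) * D" by linarith
    then have "\<bar>a + b\<bar> \<le> ((n t - m t) - (n s - m s)) * D / \<delta>"
      using \<delta> by (simp add: pos_le_divide_eq mult.commute)
    also have "\<dots> = ((n t - m t) / \<delta>\<^sup>2 - (n s - m s) / \<delta>\<^sup>2) * (t - s)"
      unfolding D power2_eq_square by (simp add: diff_divide_distrib[symmetric])
    finally have x: "\<bar>a + b\<bar> \<le> ((n t - m t) / \<delta>\<^sup>2 - (n s - m s) / \<delta>\<^sup>2) * (t - s)" .
    have "(m s - m t) * D = (- m t / \<delta> - (- m s / \<delta>)) * (t - s)"
      unfolding D by (simp add: diff_divide_distrib algebra_simps)
    moreover have "a + b = (X1 t + X2 t) - (X1 s + X2 s)" by (simp add: ab)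
    ultimately show ?thesis using x m1 by (simp add: y_def)
  qed simp
  have X: "X1 A + X2 A = X1 t + X2 t" if "A \<le> t" "t \<le> B" for t
    by (rule constant_if_square_small[of A t "\<lambda>t. X1 t + X2 t" "\<lambda>t. (n t - m t) / \<delta>\<^sup>2"])
      (use that est in auto)
  show "X1 A + X2 A = X1 B + X2 B" using X AB by simp
  show "Y1 A + Y2 A - A = Y1 B + Y2 B - B"
  proof (rule constant_if_square_small[of A B "\<lambda>t. Y1 t + Y2 t - t" "\<lambda>t. - m t / \<delta>"])
    fix s t assume st: "A \<le> s" "s \<le> t" "t \<le> B"
    then have "X1 t + X2 t - (X1 s + X2 s) = 0" using X[of s] X[of t] by simp
    then show "\<bar>Y1 t + Y2 t - t - (Y1 s + Y2 s - s)\<bar> \<le> (- m t / \<delta> - - m s / \<delta>) * (t - s)"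
      using est[OF st] by simp
  qed (rule AB)
qed

subsection \<open>Regions normalized along a diameter\<close>

text \<open>The segment from (0, 0) to (1, 0) is a diameter after rescaling. Of the frontier lying
  in \<open>G\<close>, \<open>top\<close> and \<open>bottom\<close> keep what is seen along vertical
  lines.\<close>

locale normalized_region =
  fixes G K :: "(real \<times> real) set"
  assumes hull: "K = convex hull G"
    and compact: "compact K"
    and six: "\<And>S. finite S \<Longrightarrow> card S \<le> 6 \<Longrightarrow> S \<subseteq> G \<Longrightarrow> centrally_supported S"
    and ends: "(0, 0) \<in> K" "(1, 0) \<in> K"
    and range: "\<And>x y. (x, y) \<in> K \<Longrightarrow> 0 \<le> x \<and> x \<le> 1"
    and left: "\<And>y. (0, y) \<in> K \<Longrightarrow> y = 0"
    and right: "\<And>y. (1, y) \<in> K \<Longrightarrow> y = 0"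
    and thick: "\<exists>x y d. d > 0 \<and> (x, y) \<in> K \<and> (x, y - d) \<in> K"
    and top: "\<And>x y. (x, y) \<in> K \<Longrightarrow> (\<And>d. d > 0 \<Longrightarrow> (x, y + d) \<notin> K) \<Longrightarrow> (x, y) \<in> G"
    and bottom: "\<And>x y. (x, y) \<in> K \<Longrightarrow> (\<And>d. d > 0 \<Longrightarrow> (x, y - d) \<notin> K) \<Longrightarrow> (x, y) \<in> G"
begin

section \<open>Homotheties and vertical chords\<close>

lemma combine:
  assumes "(x, y) \<in> K" "(x', y') \<in> K" "0 \<le> t" "t \<le> 1"
  shows "((1 - t) * x + t * x', (1 - t) * y + t * y') \<in> K"
  using convexD_alt[OF convex_convex_hull assms(1,2)[unfolded hull] assms(3,4)] by (simp add: hull)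

lemma shrink_left:
  assumes "(x, y) \<in> K" "0 \<le> t" "t \<le> 1" shows "(t * x, t * y) \<in> K"
  using combine[OF ends(1) assms] by simp

lemma shrink_right:
  assumes "(x, y) \<in> K" "0 \<le> t" "t \<le> 1" shows "(1 - t + t * x, t * y) \<in> K"
  using combine[OF ends(2) assms] by simp

lemma functional_bound:
  assumes "\<And>x y. (x, y) \<in> G \<Longrightarrow> b * y + a * x \<le> c" "(x, y) \<in> K"
  shows "b * y + a * x \<le> c"
  using convex_hull_le_functional[of "(x, y)" G "(a, b)" c] assms
  by (force simp: hull add.commute)

lemma vertical_between:
  assumes "(x, y) \<in> K" "(x, y') \<in> K" "y' \<le> z" "z \<le> y"
  shows "(x, z) \<in> K"
proof (cases "y = y'")
  case False
  define t where "t = (y - z) / (y - y')"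
  have t: "0 \<le> t" "t \<le> 1" using assms False by (auto simp: t_def field_simps)
  have "(1 - t) * y + t * y' = y - t * (y - y')" by (simp add: algebra_simps)
  also have "\<dots> = z" using False by (simp add: t_def)
  finally have "(1 - t) * y + t * y' = z" .
  moreover have "(1 - t) * x + t * x = x" by (simp add: algebra_simps)
  ultimately show ?thesis using combine[OF assms(1,2) t] by simp
qed (use assms in auto)

text \<open>The upper end is at height \<open>y\<close>. A chord may be a proper part of the
  vertical section of \<open>K\<close>, so a long section contains chords of all smaller
  lengths.\<close>

definition chord :: "real \<Rightarrow> real \<Rightarrow> real \<Rightarrow> bool" where
  "chord l x y \<longleftrightarrow> (x, y) \<in> K \<and> (x, y - l) \<in> K"

text \<open>Staying strictly below some chord length makes the leftmost and the rightmost chord of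
  length \<open>l\<close> distinct.\<close>

definition lengths :: "real set" where
  "lengths = {l. 0 < l \<and> (\<exists>k>l. \<exists>x y. chord k x y)}"

text \<open>The slope \<open>m\<close> belongs to the supporting lines at the upper left and lower
  right vertices, \<open>n\<close> to those at the other two.\<close>

definition parallelogram :: "real \<Rightarrow> real \<Rightarrow> real \<Rightarrow> real \<Rightarrow> real \<Rightarrow> real \<Rightarrow> real \<Rightarrow> bool" where
  "parallelogram l x1 y1 x2 y2 m n \<longleftrightarrow> chord l x1 y1 \<and> chord l x2 y2 \<and> x1 < x2 \<and>
     (\<forall>x y. chord l x y \<longrightarrow> x1 \<le> x \<and> x \<le> x2) \<and> n < m \<and>
     (\<forall>x y. (x, y) \<in> K \<longrightarrow> y - m * x \<le> y1 - m * x1 \<and> y2 - l - m * x2 \<le> y - m * x \<and>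
                         y - n * x \<le> y2 - n * x2 \<and> y1 - l - n * x1 \<le> y - n * x)"

lemma chord_inside:
  assumes "chord l x y" "l > 0" shows "0 < x" "x < 1"
proof -
  have "x \<noteq> 0" "x \<noteq> 1" using assms left[of y] left[of "y - l"] right[of y] right[of "y - l"]
    by (auto simp: chord_def)
  then show "0 < x" "x < 1" using range[of x y] assms by (auto simp: chord_def)
qed

text \<open>Homotheties of ratio \<open>l / k\<close> about the two ends of the axis shrink the
  chord and move it to the left and to the right.\<close>

lemma chord_shrink:
  assumes "chord k x y" "0 < l" "l < k"
  shows "chord l (l / k * x) (l / k * y)" "chord l (1 - l / k + l / k * x) (l / k * y)"
    "l / k * x < x" "x < 1 - l / k + l / k * x"
proof -
  have t: "0 \<le> l / k" "l / k \<le> 1" "l / k < 1" "l / k * k = l" using assms by auto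
  have e: "l / k * (y - k) = l / k * y - l" using assms by (simp add: right_diff_distrib)
  show "chord l (l / k * x) (l / k * y)"
    using shrink_left[OF _ t(1,2), of x y] shrink_left[OF _ t(1,2), of x "y - k"] assms(1)
    unfolding e chord_def by blast
  show "chord l (1 - l / k + l / k * x) (l / k * y)"
    using shrink_right[OF _ t(1,2), of x y] shrink_right[OF _ t(1,2), of x "y - k"] assms(1)
    unfolding e chord_def by blast
  have x: "0 < x" "x < 1" using chord_inside[OF assms(1)] assms by auto
  have "l / k * x < 1 * x" by (rule mult_strict_right_mono[OF t(3) x(1)])
  then show "l / k * x < x" by simp
  have "l / k * (1 - x) < 1 * (1 - x)" using t(3) x(2) by (intro mult_strict_right_mono) auto
  then show "x < 1 - l / k + l / k * x" by (simp add: right_diff_distrib)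
qed

lemma compact_chords: "compact {z. chord l (fst z) (snd z)}"
proof -
  have "{z. chord l (fst z) (snd z)} = K \<inter> (\<lambda>z. z - (0, l)) -` K"
    by (auto simp: chord_def)
  moreover have "closed ((\<lambda>z. z - (0, l)) -` K)"
    using compact compact_imp_closed by (intro continuous_closed_vimage) auto
  ultimately show ?thesis using compact by (simp add: compact_Int_closed)
qed

text \<open>Extending the chord upwards or downwards would give a longer chord at the same
  abscissa.\<close>

lemma extremal_chord_in_curve:
  assumes c: "chord l x y" and l: "l > 0"
    and no_longer: "\<And>k y'. k > l \<Longrightarrow> \<not> chord k x y'"
  shows "(x, y) \<in> G" "(x, y - l) \<in> G"
proof -
  show "(x, y) \<in> G"
  proof (rule top)
    fix d :: real assume "d > 0"
    then show "(x, y + d) \<notin> K" using no_longer[of "l + d" "y + d"] c by (auto simp: chord_def)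
  qed (use c in \<open>simp add: chord_def\<close>)
  show "(x, y - l) \<in> G"
  proof (rule bottom)
    fix d :: real assume "d > 0"
    then show "(x, y - l - d) \<notin> K" using no_longer[of "l + d" y] c by (auto simp: chord_def diff_diff_eq)
  qed (use c in \<open>simp add: chord_def\<close>)
qed

text \<open>The extremal chords of length \<open>l\<close> exist by compactness. Longer chords lie
  strictly between them by \<open>chord_shrink\<close>, so these two are full sections and end on
  the curve. \<open>K\<close> leaves the strip between them at (0, 0), and the other strip because
  it has a chord longer than \<open>l\<close>.\<close>

lemma parallelogram_exists:
  assumes "l \<in> lengths"
  shows "\<exists>x1 y1 x2 y2 m n. parallelogram l x1 y1 x2 y2 m n"
proof -
  obtain k x0 y0 where l: "0 < l" "l < k" and k: "chord k x0 y0"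
    using assms by (auto simp: lengths_def)
  let ?H = "{z. chord l (fst z) (snd z)}"
  have ne: "?H \<noteq> {}" using chord_shrink(1)[OF k l] by (metis (mono_tags) empty_Collect_eq fst_conv snd_conv)
  have cont: "continuous_on ?H fst" by (intro continuous_intros)
  obtain z1 where z1: "z1 \<in> ?H" "\<forall>z\<in>?H. fst z1 \<le> fst z"
    using continuous_attains_inf[OF compact_chords ne cont] by blast
  obtain z2 where z2: "z2 \<in> ?H" "\<forall>z\<in>?H. fst z \<le> fst z2"
    using continuous_attains_sup[OF compact_chords ne cont] by blast
  define x1 y1 x2 y2 where xy: "x1 = fst z1" "y1 = snd z1" "x2 = fst z2" "y2 = snd z2"
  have c1: "chord l x1 y1" and c2: "chord l x2 y2" using z1 z2 by (auto simp: xy)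
  have between: "x1 \<le> x \<and> x \<le> x2" if "chord l x y" for x y
    using z1(2)[rule_format, of "(x, y)"] z2(2)[rule_format, of "(x, y)"] that by (auto simp: xy)
  have strict: "x1 < x \<and> x < x2" if c: "chord j x y" and j: "l < j" for j x y
    using chord_shrink[OF c l(1) j] between by (meson le_less_trans less_le_trans)
  have x12: "x1 < x2" using strict[OF k l(2)] by simp
  have G1: "(x1, y1) \<in> G" "(x1, y1 - l) \<in> G"
    by (rule extremal_chord_in_curve[OF c1 l(1)]; use strict in blast)+
  have G2: "(x2, y2) \<in> G" "(x2, y2 - l) \<in> G"
    by (rule extremal_chord_in_curve[OF c2 l(1)]; use strict in blast)+
  have side: "\<exists>z\<in>G. fst z < x1"
  proof (rule ccontr)
    assume "\<not> ?thesis"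
    then have "0 * y + (- 1) * x \<le> - x1" if "(x, y) \<in> G" for x y using that by force
    from functional_bound[OF this ends(1)] show False using chord_inside[OF c1 l(1)] by simp
  qed
  define w where "w = (y2 - y1) / (x2 - x1)"
  \<comment> \<open>The strip between the upper and lower sides has vertical width \<open>l\<close>,
    too little for the chord of length \<open>k\<close> at \<open>x0\<close>.\<close>
  have topbot: "\<exists>z\<in>G. snd z > y1 + w * (fst z - x1) \<or> snd z < y1 - l + w * (fst z - x1)"
  proof (rule ccontr)
    assume n: "\<not> ?thesis"
    have "1 * y + (- w) * x \<le> y1 - w * x1" if "(x, y) \<in> G" for x y
      using n that by (force simp: not_less algebra_simps)
    from functional_bound[OF this] k have "y0 - w * x0 \<le> y1 - w * x1" by (auto simp: chord_def)
    moreover have "(- 1) * y + w * x \<le> - (y1 - l - w * x1)" if "(x, y) \<in> G" for x y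
      using n that by (force simp: not_less algebra_simps)
    from functional_bound[OF this] k have "y1 - l - w * x1 \<le> y0 - k - w * x0"
      by (fastforce simp: chord_def)
    ultimately show False using l by linarith
  qed
  obtain m n where "n < m"
    and m: "\<And>x y. (x, y) \<in> G \<Longrightarrow> y - m * x \<le> y1 - m * x1 \<and> y2 - l - m * x2 \<le> y - m * x"
    and n: "\<And>x y. (x, y) \<in> G \<Longrightarrow> y - n * x \<le> y2 - n * x2 \<and> y1 - l - n * x1 \<le> y - n * x"
    by (rule parallelogram_slopes[OF _ G1 G2 x12 l(1) side topbot[unfolded w_def]])
      (use six in blast)+
  have "y - m * x \<le> y1 - m * x1 \<and> y2 - l - m * x2 \<le> y - m * x \<and>
        y - n * x \<le> y2 - n * x2 \<and> y1 - l - n * x1 \<le> y - n * x" if K: "(x, y) \<in> K" for x y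
    using functional_bound[OF _ K, of 1 "- m" "y1 - m * x1"]
      functional_bound[OF _ K, of "- 1" m "- (y2 - l - m * x2)"]
      functional_bound[OF _ K, of 1 "- n" "y2 - n * x2"]
      functional_bound[OF _ K, of "- 1" n "- (y1 - l - n * x1)"] m n by force
  then show ?thesis using c1 c2 x12 between \<open>n < m\<close> unfolding parallelogram_def by blast
qed

text \<open>The pair \<open>(cx, cy)\<close> is twice the centre. All lengths between two members of
  \<open>lengths\<close> are members, so \<open>center_constant\<close> compares any two of
  them.\<close>

lemma common_center:
  obtains cx cy where "\<And>l. l \<in> lengths \<Longrightarrow>
     \<exists>x1 y1 x2 y2 m n. parallelogram l x1 y1 x2 y2 m n \<and> x1 + x2 = cx \<and> y1 + y2 - l = cy"
proof -
  have "\<forall>l\<in>lengths. \<exists>q. case q of (x1, y1, x2, y2, m, n) \<Rightarrow> parallelogram l x1 y1 x2 y2 m n"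
    using parallelogram_exists by simp
  then obtain F where F: "\<forall>l\<in>lengths. case F l of (x1, y1, x2, y2, m, n) \<Rightarrow> parallelogram l x1 y1 x2 y2 m n"
    using bchoice by meson
  define X1 Y1 X2 Y2 m n where defs: "X1 l = fst (F l)" "Y1 l = fst (snd (F l))"
    "X2 l = fst (snd (snd (F l)))" "Y2 l = fst (snd (snd (snd (F l))))"
    "m l = fst (snd (snd (snd (snd (F l)))))" "n l = snd (snd (snd (snd (snd (F l)))))" for l
  have par: "parallelogram l (X1 l) (Y1 l) (X2 l) (Y2 l) (m l) (n l)" if "l \<in> lengths" for l
    using F[rule_format, OF that] by (simp add: defs case_prod_beta)
  have eq: "X1 A + X2 A = X1 B + X2 B \<and> Y1 A + Y2 A - A = Y1 B + Y2 B - B"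
    if AB: "A \<in> lengths" "B \<in> lengths" "A \<le> B" for A B
  proof -
    have len: "l \<in> lengths" if "A \<le> l" "l \<le> B" for l
      using AB that unfolding lengths_def by (auto intro: less_le_trans) (meson le_less_trans)
    note P = par[OF len, unfolded parallelogram_def chord_def]
    have Kin: "(X1 l, Y1 l) \<in> K" "(X1 l, Y1 l - l) \<in> K" "(X2 l, Y2 l) \<in> K" "(X2 l, Y2 l - l) \<in> K"
      if "A \<le> l" "l \<le> B" for l using P[OF that] by blast+
    have sl: "n l < m l" if "A \<le> l" "l \<le> B" for l using P[OF that] by blast
    have sup: "y - m l * x \<le> Y1 l - m l * X1 l \<and> Y2 l - l - m l * X2 l \<le> y - m l * x \<and>
       y - n l * x \<le> Y2 l - n l * X2 l \<and> Y1 l - l - n l * X1 l \<le> y - n l * x"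
      if "A \<le> l" "l \<le> B" "(x, y) \<in> K" for l x y using P[OF that(1,2)] that(3) by blast
    have "X1 A + X2 A = X1 B + X2 B" "Y1 A + Y2 A - A = Y1 B + Y2 B - B"
      by (rule center_constant[OF AB(3), of n m Y1 X1 Y2 X2]; use sl sup Kin in blast)+
    then show ?thesis by blast
  qed
  show ?thesis
  proof (cases "lengths = {}")
    case False
    then obtain l0 where l0: "l0 \<in> lengths" by blast
    show ?thesis
    proof (rule that[of "X1 l0 + X2 l0" "Y1 l0 + Y2 l0 - l0"])
      fix l assume l: "l \<in> lengths"
      have "X1 l + X2 l = X1 l0 + X2 l0 \<and> Y1 l + Y2 l - l = Y1 l0 + Y2 l0 - l0"
        using eq[OF l l0] eq[OF l0 l] linear[of l l0] by metis
      then show "\<exists>x1 y1 x2 y2 m n. parallelogram l x1 y1 x2 y2 m n \<and>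
          x1 + x2 = X1 l0 + X2 l0 \<and> y1 + y2 - l = Y1 l0 + Y2 l0 - l0"
        using par[OF l] by blast
    qed
  qed (use that in blast)
qed

text \<open>The part \<open>R\<close> of \<open>K\<close> whose reflection stays in \<open>K\<close>
  is closed and convex. Reflection swaps opposite vertices of each parallelogram, so all
  parallelograms lie in \<open>R\<close>, and they come arbitrarily close to every point of
  \<open>K\<close> with abscissa strictly between 0 and 1.\<close>

theorem symmetric: "\<exists>c. \<forall>z\<in>K. c - z \<in> K"
proof -
  obtain cx cy where center: "\<And>l. l \<in> lengths \<Longrightarrow>
     \<exists>x1 y1 x2 y2 m n. parallelogram l x1 y1 x2 y2 m n \<and> x1 + x2 = cx \<and> y1 + y2 - l = cy"
    using common_center by blast
  define R where "R = {z \<in> K. (cx, cy) - z \<in> K}"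
  have R_eq: "R = K \<inter> (\<lambda>z. (cx, cy) - z) -` K" by (auto simp: R_def)
  have clK: "closed K" using compact compact_imp_closed by blast
  have clR: "closed R" unfolding R_eq
    using clK by (intro closed_Int continuous_closed_vimage) auto
  have combR: "((1 - t) * x + t * x', (1 - t) * y + t * y') \<in> R"
    if "(x, y) \<in> R" "(x', y') \<in> R" "0 \<le> t" "t \<le> 1" for x y x' y' t
  proof -
    have "cx - ((1 - t) * x + t * x') = (1 - t) * (cx - x) + t * (cx - x')"
      "cy - ((1 - t) * y + t * y') = (1 - t) * (cy - y) + t * (cy - y')" by (simp_all add: algebra_simps)
    then show ?thesis
      using that combine[of x y x' y' t] combine[of "cx - x" "cy - y" "cx - x'" "cy - y'" t]
      by (auto simp: R_def)
  qed
  have inner: "(x, y) \<in> R" if K: "(x, y) \<in> K" and x: "0 < x" "x < 1" for x y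
  proof -
    let ?V = "Pair x -` K"
    have cV: "compact ?V"
    proof -
      have "?V = snd ` (K \<inter> {z. fst z = x})" by force
      moreover have "closed {z::real \<times> real. fst z = x}"
        by (intro closed_Collect_eq continuous_intros)
      ultimately show ?thesis using compact
        by (auto intro!: compact_continuous_image continuous_intros compact_Int_closed)
    qed
    have neV: "?V \<noteq> {}" using K by auto
    obtain u where u: "(x, u) \<in> K" "\<And>y. (x, y) \<in> K \<Longrightarrow> y \<le> u"
      using compact_attains_sup[OF cV neV] by auto
    obtain v where v: "(x, v) \<in> K" "\<And>y. (x, y) \<in> K \<Longrightarrow> v \<le> y"
      using compact_attains_inf[OF cV neV] by auto
    \<comment> \<open>Homotheties about the ends of the axis carry one nondegenerate vertical chord
      to every abscissa between 0 and 1.\<close>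
    have uv: "v < u"
    proof -
      obtain a b d where d: "d > 0" "(a, b) \<in> K" "(a, b - d) \<in> K" using thick by blast
      then have a: "0 < a" "a < 1" using chord_inside[of d a b] by (auto simp: chord_def)
      show ?thesis
      proof (cases "x \<le> a")
        case True
        define t where "t = x / a"
        have t: "0 < t" "t \<le> 1" "t * a = x" using True a x by (auto simp: t_def)
        then have "(x, t * b) \<in> K" "(x, t * (b - d)) \<in> K"
          using shrink_left[OF d(2), of t] shrink_left[OF d(3), of t] by auto
        then have "t * b \<le> u" "v \<le> t * (b - d)" using u v by auto
        moreover have "t * (b - d) < t * b" using t d by simp
        ultimately show ?thesis by linarith
      next
        case False
        define t where "t = (1 - x) / (1 - a)"
        have "t * (1 - a) = 1 - x" using a by (simp add: t_def)
        then have e: "1 - t + t * a = x" by (simp add: right_diff_distrib)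
        have t: "0 < t" "t \<le> 1" using False a x by (auto simp: t_def)
        then have "(x, t * b) \<in> K" "(x, t * (b - d)) \<in> K"
          using shrink_right[OF d(2), of t] shrink_right[OF d(3), of t] e by auto
        then have "t * b \<le> u" "v \<le> t * (b - d)" using u v by auto
        moreover have "t * (b - d) < t * b" using t d by simp
        ultimately show ?thesis by linarith
      qed
    qed
    \<comment> \<open>For \<open>l\<close> close to \<open>u - v\<close>, the parallelogram of height \<open>l\<close> lies in \<open>R\<close> and covers all but
        a length \<open>u - v - l\<close> of the chord through \<open>(x, y)\<close>.\<close>
    have "\<exists>z\<in>R. dist z (x, y) < e" if e: "e > 0" for e
    proof -
      \<comment> \<open>The first term keeps \<open>l\<close> positive, the second brings it within
        \<open>e / 2\<close> of \<open>u - v\<close>.\<close>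
      define l where "l = max ((u - v) / 2) (u - v - e / 2)"
      have l: "0 < l" "l < u - v" "u - v - l < e" using uv e by (auto simp: l_def less_max_iff_disj)
      have ch: "chord (u - v) x u" using u v by (simp add: chord_def)
      have "l \<in> lengths" using l ch by (auto simp: lengths_def)
      from center[OF this] obtain x1 y1 x2 y2 m n where P: "parallelogram l x1 y1 x2 y2 m n"
        and c: "cx = x1 + x2" "cy = y1 + y2 - l" by blast
      have Kin: "(x1, y1) \<in> K" "(x1, y1 - l) \<in> K" "(x2, y2) \<in> K" "(x2, y2 - l) \<in> K"
        and x12: "x1 < x2" and bet: "\<And>x y. chord l x y \<Longrightarrow> x1 \<le> x \<and> x \<le> x2"
        using P by (auto simp: parallelogram_def chord_def)
      have Rin: "(x1, y1) \<in> R" "(x1, y1 - l) \<in> R" "(x2, y2) \<in> R" "(x2, y2 - l) \<in> R"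
        using Kin by (auto simp: R_def c)
      \<comment> \<open>There is a chord of length \<open>l\<close> at \<open>x\<close>, so
        \<open>x\<close> lies between the vertical sides of the parallelogram, whose section there
        will run from \<open>w - l\<close> to \<open>w\<close>.\<close>
      have "(x, u - l) \<in> K" by (rule vertical_between[OF u(1) v(1)]) (use l in auto)
      then have "chord l x u" using u by (simp add: chord_def)
      from bet[OF this] have x_bet: "x1 \<le> x" "x \<le> x2" by auto
      define t where "t = (x - x1) / (x2 - x1)"
      have t: "0 \<le> t" "t \<le> 1" using x_bet x12 by (auto simp: t_def)
      have "t * (x2 - x1) = x - x1" using x12 by (simp add: t_def)
      then have tx: "(1 - t) * x1 + t * x2 = x" by (simp add: algebra_simps)
      define w where "w = (1 - t) * y1 + t * y2"
      have w_l: "(1 - t) * (y1 - l) + t * (y2 - l) = w - l" by (simp add: w_def algebra_simps)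
      have w1: "(x, w) \<in> R" using combR[OF Rin(1,3) t] by (simp add: tx w_def)
      have w2: "(x, w - l) \<in> R" using combR[OF Rin(2,4) t] by (simp add: tx w_l)
      have bounds: "w \<le> u" "v \<le> w - l" "y \<le> u" "v \<le> y" using w1 w2 u v K by (auto simp: R_def)
      consider "w < y" | "y < w - l" | "w - l \<le> y" "y \<le> w" by linarith
      then show ?thesis
      proof cases
        case 1
        then show ?thesis using w1 bounds l by (intro bexI[of _ "(x, w)"]) (auto simp: dist_Pair_Pair dist_real_def)
      next
        case 2
        then show ?thesis using w2 bounds l by (intro bexI[of _ "(x, w - l)"]) (auto simp: dist_Pair_Pair dist_real_def)
      next
        case 3
        define s where "s = (w - y) / l"
        have s: "0 \<le> s" "s \<le> 1" using 3 l by (auto simp: s_def)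
        have sl: "s * l = w - y" using l by (simp add: s_def)
        have "(1 - s) * w + s * (w - l) = w - s * l" "(1 - s) * x + s * x = x" by (simp_all add: algebra_simps)
        then have "(x, y) \<in> R" using combR[OF w1 w2 s] by (simp add: sl)
        then show ?thesis using e by (intro bexI[of _ "(x, y)"]) auto
      qed
    qed
    then have "(x, y) \<in> closure R" by (simp add: closure_approachable)
    then show ?thesis using clR by simp
  qed
  have axis: "(t, 0) \<in> K" if "0 \<le> t" "t \<le> 1" for t :: real
    using combine[OF ends that] by simp
  \<comment> \<open>The two ends of the axis are limits of axis points already known to be in
    \<open>R\<close>.\<close>
  have "{0<..<1} \<subseteq> (\<lambda>t. (t, 0)) -` R" using inner axis by auto
  moreover have "closed ((\<lambda>t::real. (t, 0::real)) -` R)"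
    by (intro continuous_closed_vimage[OF clR]) (auto intro!: continuous_intros)
  ultimately have "closure {0<..<1} \<subseteq> (\<lambda>t. (t, 0)) -` R" by (rule closure_minimal)
  then have "(t, 0) \<in> R" if "t \<in> {0..1}" for t using that by (simp add: subset_eq)
  from this[of 0] this[of 1] have ends_R: "(0, 0) \<in> R" "(1, 0) \<in> R" by simp_all
  have "z \<in> R" if zK: "z \<in> K" for z
  proof -
    obtain x y where z: "z = (x, y)" by (cases z)
    consider "x = 0" | "x = 1" | "0 < x" "x < 1" using range[of x y] zK unfolding z by fastforce
    then show ?thesis
    proof cases
      case 1
      then show ?thesis using left[of y] zK z ends_R by simp
    next
      case 2
      then show ?thesis using right[of y] zK z ends_R by simp
    qed (use inner zK z in auto)
  qed
  then show ?thesis by (intro exI[of _ "(cx, cy)"]) (auto simp: R_def)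
qed

end

subsection \<open>Reduction to normalized coordinates\<close>

lemma infinite_simple_path_image:
  fixes g :: "real \<Rightarrow> 'a::topological_space"
  assumes "simple_path g" shows "infinite (path_image g)"
proof
  assume "finite (path_image g)"
  moreover have "g ` {0<..<1} \<subseteq> path_image g" by (auto simp: path_image_def)
  ultimately have fin: "finite (g ` {0<..<1})" using finite_subset by blast
  have "inj_on g {0<..<1}"
    using assms by (force simp: inj_on_def simple_path_def loop_free_def)
  then have "finite {0<..<1::real}" using fin finite_imageD by blast
  then show False using infinite_Ioo[of 0 "1::real"] by simp
qed

lemma interior_move_along:
  fixes v :: "'a::real_normed_vector"
  assumes "p \<in> interior K"
  obtains \<delta> where "\<delta> > 0" "p + \<delta> *\<^sub>R v \<in> K" "p - \<delta> *\<^sub>R v \<in> K"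
proof -
  obtain e where e: "e > 0" "ball p e \<subseteq> K" using assms mem_interior by blast
  define \<delta> where "\<delta> = e / (2 * (norm v + 1))"
  have n: "norm v + 1 > 0" using norm_ge_zero[of v] by linarith
  then have n0: "norm v + 1 \<noteq> 0" by simp
  have \<delta>: "\<delta> > 0" using e n by (simp add: \<delta>_def)
  have "\<delta> * norm v \<le> \<delta> * (norm v + 1)" using \<delta> by (intro mult_left_mono) auto
  also have "\<dots> = e / 2" using n0 unfolding \<delta>_def by (metis nonzero_mult_divide_mult_cancel_right times_divide_eq_left)
  also have "\<dots> < e" using e by simp
  finally have "p + \<delta> *\<^sub>R v \<in> ball p e" "p - \<delta> *\<^sub>R v \<in> ball p e" using \<delta> by (auto simp: dist_norm)
  then show ?thesis using that \<delta> e by blast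
qed

text \<open>The diameter from \<open>a\<close> to \<open>b\<close> becomes the unit segment, in
  coordinates along orthogonal vectors \<open>d\<close> and \<open>e\<close> of equal length. No
  point of \<open>K\<close> is farther than the diameter from \<open>a\<close> or \<open>b\<close>,
  so \<open>K\<close> becomes part of the lens of the unit discs about (0, 0) and (1, 0). The lens
  lies over the unit interval and meets the vertical lines at 0 and 1 only in the ends of the
  axis.\<close>

lemma centrally_symmetric_if_six:
  fixes G :: "(real^2) set"
  defines "K \<equiv> convex hull G"
  assumes compact: "compact K" and int: "interior K \<noteq> {}" and fr: "frontier K \<subseteq> G"
    and six: "\<And>S. finite S \<Longrightarrow> card S \<le> 6 \<Longrightarrow> S \<subseteq> G \<Longrightarrow> centrally_supported S"
  shows "centrally_symmetric K"
proof -
  have neK: "K \<noteq> {}" using int interior_subset by blast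
  obtain a b where ab: "a \<in> K" "b \<in> K" "dist a b = diameter K"
    using diameter_compact_attained[OF compact neK] by blast
  have diam: "dist x y \<le> dist a b" if "x \<in> K" "y \<in> K" for x y
    using diameter_bounded_bound[OF compact_imp_bounded[OF compact] that] ab(3) by simp
  define d where "d = b - a"
  define e :: "real^2" where "e = vector [- d $ 2, d $ 1]"
  define D where "D = d \<bullet> d"
  have "a \<noteq> b"
  proof
    assume "a = b"
    then have "x = a" if "x \<in> K" for x using diam[OF that ab(1)] by simp
    then have "K \<subseteq> {a}" by blast
    then show False using int by (metis interior_mono interior_singleton subset_empty)
  qed
  then have D: "D > 0" by (simp add: D_def d_def)
  have orth: "d \<bullet> e = 0" "e \<bullet> e = D" by (simp_all add: D_def e_def inner_vec2 algebra_simps)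
  define T :: "real \<times> real \<Rightarrow> real^2" where "T z = fst z *\<^sub>R d + snd z *\<^sub>R e" for z
  define L :: "real^2 \<Rightarrow> real \<times> real" where "L x = (x \<bullet> d / D, x \<bullet> e / D)" for x
  have linT: "linear T" by (auto simp: linear_iff T_def algebra_simps)
  have linL: "linear L" by (auto simp: linear_iff L_def inner_add_left add_divide_distrib)
  have LT: "L (T z) = z" for z
    using D orth by (cases z) (simp add: L_def T_def inner_add_left inner_commute[of e d] flip: D_def)
  have TL: "T (L x) = x" for x
  proof -
    have n: "d$1 * d$1 + d$2 * d$2 > 0" using D by (simp add: D_def inner_vec2)
    have "D * (T (L x) $ i) = D * x $ i" for i
      using exhaust_2[of i] D
      by (auto simp: T_def L_def distrib_left) (auto simp: D_def e_def inner_vec2 algebra_simps)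
    then show ?thesis using D by (simp add: vec_eq_iff)
  qed
  have surT: "surj T" using TL by (metis surjI)
  define G' where "G' = {z. a + T z \<in> G}"
  define K' where "K' = {z. a + T z \<in> K}"
  \<comment> \<open>The preimage is rewritten as an image under the inverse map, since hulls and
    compactness pass to such images.\<close>
  have vimage: "{z. a + T z \<in> S} = L ` ((+) (- a) ` S)" for S
  proof (intro equalityI subsetI)
    fix z assume "z \<in> {z. a + T z \<in> S}"
    then have "- a + (a + T z) \<in> (+) (- a) ` S" by blast
    then show "z \<in> L ` ((+) (- a) ` S)" using LT[of z] by (metis add_minus_cancel imageI minus_add_cancel)
  qed (auto simp: TL)
  have dist_sq: "(dist (a + T (x, y)) (a + T (x', y')))\<^sup>2 = ((x - x')\<^sup>2 + (y - y')\<^sup>2) * D" for x y x' y'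
  proof -
    have "(a + T (x, y)) - (a + T (x', y')) = (x - x') *\<^sub>R d + (y - y') *\<^sub>R e"
      by (simp add: T_def algebra_simps)
    then show ?thesis using orth
      unfolding dist_norm power2_norm_eq_inner D_def
      by (simp only: inner_add_left inner_add_right inner_scaleR_left inner_scaleR_right
          inner_commute[of e d] power2_eq_square) (simp add: algebra_simps)
  qed
  have T_ends: "a + T (0, 0) = a" "a + T (1, 0) = b" by (simp_all add: T_def d_def)
  have in_disc: "(x - x')\<^sup>2 + (y - y')\<^sup>2 \<le> 1" if "(x, y) \<in> K'" "(x', y') \<in> K'" for x y x' y'
  proof -
    have "(dist (a + T (x, y)) (a + T (x', y')))\<^sup>2 \<le> (dist a b)\<^sup>2"
      by (intro power_mono diam) (use that in \<open>simp_all add: K'_def\<close>)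
    also have "(dist a b)\<^sup>2 = D" using dist_sq[of 0 0 1 0] by (simp add: T_ends)
    finally have "((x - x')\<^sup>2 + (y - y')\<^sup>2) * D \<le> 1 * D" unfolding dist_sq by simp
    then show ?thesis using D by simp
  qed
  have ends: "(0, 0) \<in> K'" "(1, 0) \<in> K'" using ab by (simp_all only: K'_def mem_Collect_eq T_ends)
  have near_ends: "x\<^sup>2 + y\<^sup>2 \<le> 1" "(x - 1)\<^sup>2 + y\<^sup>2 \<le> 1" if "(x, y) \<in> K'" for x y
    using in_disc[OF that ends(1)] in_disc[OF that ends(2)] by simp_all
  have vert: "a + T (x, y + \<delta>) = (a + T (x, y)) + \<delta> *\<^sub>R e"
    "a + T (x, y - \<delta>) = (a + T (x, y)) - \<delta> *\<^sub>R e" for x y \<delta>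
    by (simp_all add: T_def algebra_simps)
  have interior_G: "p \<in> interior K" if "p \<in> K" "p \<notin> G" for p
    using that fr compact_imp_closed[OF compact] by (auto simp: frontier_def)
  interpret normalized_region G' K'
  proof
    show "K' = convex hull G'"
      unfolding K'_def G'_def vimage K_def
      by (simp only: convex_hull_linear_image[OF linL, symmetric] convex_hull_translation)
    show "compact K'"
      unfolding K'_def vimage
      by (intro compact_continuous_image linear_continuous_on compact_translation compact)
        (simp add: linL linear_conv_bounded_linear[symmetric])
    show "centrally_supported S" if "finite S" "card S \<le> 6" "S \<subseteq> G'" for S
    proof (rule centrally_supported_affine_vimage[OF linT surT, of a], rule six)
      show "card ((\<lambda>x. a + T x) ` S) \<le> 6" using that(1,2) card_image_le order_trans by blast
    qed (use that in \<open>auto simp: G'_def\<close>)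
    show "(0, 0) \<in> K'" "(1, 0) \<in> K'" by (fact ends)+
    show "0 \<le> x \<and> x \<le> 1" if "(x, y) \<in> K'" for x y
    proof -
      have "x\<^sup>2 \<le> 1" "(x - 1)\<^sup>2 \<le> 1" using near_ends[OF that] zero_le_power2[of y] by linarith+
      then have "\<bar>x\<bar> \<le> 1" "\<bar>x - 1\<bar> \<le> 1" by (simp_all add: abs_square_le_1)
      then show ?thesis by linarith
    qed
    show "y = 0" if "(0, y) \<in> K'" for y using near_ends(2)[OF that] by simp
    show "y = 0" if "(1, y) \<in> K'" for y using near_ends(1)[OF that] by simp
    show "\<exists>x y d. d > 0 \<and> (x, y) \<in> K' \<and> (x, y - d) \<in> K'"
    proof -
      obtain p where "p \<in> interior K" using int by blast
      from interior_move_along[OF this, of e] obtain \<delta>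
        where \<delta>: "\<delta> > 0" "p - \<delta> *\<^sub>R e \<in> K" by blast
      obtain x y where xy: "L (p - a) = (x, y)" by (cases "L (p - a)")
      then have p: "a + T (x, y) = p" using TL[of "p - a"] by simp
      have "p \<in> K" using \<open>p \<in> interior K\<close> interior_subset by blast
      then have "(x, y) \<in> K'" "(x, y - \<delta>) \<in> K'" using \<delta> unfolding K'_def mem_Collect_eq vert p by auto
      then show ?thesis using \<delta> by blast
    qed
    show "(x, y) \<in> G'" if "(x, y) \<in> K'" "\<And>d. d > 0 \<Longrightarrow> (x, y + d) \<notin> K'" for x y
    proof (rule ccontr)
      assume "(x, y) \<notin> G'"
      then have "a + T (x, y) \<in> interior K" using interior_G that(1) by (simp add: K'_def G'_def)
      from interior_move_along[OF this, of e] obtain \<delta>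
        where "\<delta> > 0" "(a + T (x, y)) + \<delta> *\<^sub>R e \<in> K" by blast
      then show False using that(2)[of \<delta>] unfolding K'_def mem_Collect_eq vert by blast
    qed
    show "(x, y) \<in> G'" if "(x, y) \<in> K'" "\<And>d. d > 0 \<Longrightarrow> (x, y - d) \<notin> K'" for x y
    proof (rule ccontr)
      assume "(x, y) \<notin> G'"
      then have "a + T (x, y) \<in> interior K" using interior_G that(1) by (simp add: K'_def G'_def)
      from interior_move_along[OF this, of e] obtain \<delta>
        where "\<delta> > 0" "(a + T (x, y)) - \<delta> *\<^sub>R e \<in> K" by blast
      then show False using that(2)[of \<delta>] unfolding K'_def mem_Collect_eq vert by blast
    qed
  qed
  obtain c where c: "\<forall>z\<in>K'. c - z \<in> K'" using symmetric by blast
  show ?thesis unfolding centrally_symmetric_def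
  proof (intro exI ballI)
    fix x assume "x \<in> K"
    then have "L (x - a) \<in> K'" by (simp add: K'_def TL)
    then have "c - L (x - a) \<in> K'" using c by blast
    then have "a + T (c - L (x - a)) \<in> K" by (simp add: K'_def)
    also have "a + T (c - L (x - a)) = 2 *\<^sub>R (a + (1/2) *\<^sub>R T c) - x"
      by (simp add: linear_diff[OF linT] TL scaleR_2 algebra_simps)
    finally show "2 *\<^sub>R (a + (1/2) *\<^sub>R T c) - x \<in> K" .
  qed
qed

theorem theorem2:
  fixes g :: "real \<Rightarrow> real^2"
  assumes "simple_path g" and "pathfinish g = pathstart g"
    and "\<And>S. S \<subseteq> path_image g \<Longrightarrow> card S = 6 \<Longrightarrow> csc_position S"
  shows "\<exists>K. convex_body K \<and> centrally_symmetric K \<and> frontier K = path_image g"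
proof -
  let ?G = "path_image g"
  let ?K = "convex hull ?G"
  have cG: "compact ?G" using assms(1) compact_simple_path_image by blast
  have cK: "compact ?K" using cG compact_convex_hull by blast
  have six: "centrally_supported S" if S: "finite S" "card S \<le> 6" "S \<subseteq> ?G" for S
  proof -
    \<comment> \<open>Smaller sets are padded with further points of the curve to exactly
      six.\<close>
    have "infinite (?G - S)" using infinite_simple_path_image[OF assms(1)] S(1) by simp
    then obtain T where T: "finite T" "card T = 6 - card S" "T \<subseteq> ?G - S"
      using infinite_arbitrarily_large by blast
    then have "card (S \<union> T) = 6" using S by (subst card_Un_disjoint) auto
    then have "csc_position (S \<union> T)" using assms(3) S T by blast
    from csc_position_imp_centrally_supported[OF this] show ?thesis
      by (rule centrally_supported_subset) simp
  qed
  have "p \<notin> interior ?K" if p: "p \<in> ?G" for p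
  proof (rule locally_supported_not_interior[OF compact_imp_bounded[OF cG] _ compact_imp_closed[OF cK] p])
    fix S q assume S: "finite S" "card S \<le> 4" "S \<subseteq> ?G" "q \<in> ?G"
    then have "centrally_supported (insert q S)"
      by (intro six) (auto simp: card_insert_if)
    then show "\<exists>f. f \<noteq> 0 \<and> (\<forall>y\<in>S. f \<bullet> y \<le> f \<bullet> q)"
      unfolding centrally_supported_def by blast
  qed
  then have "?G \<inter> interior ?K = {}" by blast
  note K = closed_curve_eq_frontier_convex_hull[OF assms(1,2) this]
  have "centrally_symmetric ?K" by (rule centrally_symmetric_if_six) (use cK K six in auto)
  then show ?thesis using K cK unfolding convex_body_def by blast
qed

end
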